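(* The completion of $\mathcal{R}_1$ for the Hadamard norm $\|\cdot\|_H$ is canonically identified with the set $\mathcal{H}_1$ of Hadamard functions $f$ with $f(0)=1$. Explicitly, identify the completion of $\mathbb{Z}[\mathbb{C}^\times]=\mathcal{R}_1$ for $\|\cdot\|_H$ with the set of formal sums $\sum_{a\in\mathbb{C}^\times}k_a[a]$ with $k_a\in\mathbb{Z}$ and $\sum_a|k_a||a|<\infty$. Then the map $$\sum_{a}k_a[a]\longmapsto \prod_{a}(1-at)^{-k_a}=\frac{\prod_{a:\,k_a<0}(1-at)^{-k_a}}{\prod_{a:\,k_a>0}(1-at)^{k_a}}$$ (in which the numerator and the denominator converge uniformly on compact subsets of $\mathbb{C}$ to entire functions of genus zero) is a bijection from this completion onto $\mathcal{H}_1$, extending the bijection $\mathbb{Z}[\mathbb{C}^\times]\to\mathcal{R}_1$.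
   Context: $\mathcal{R}_1$ is the set of rational functions $f\in\mathbb{C}(t)$ with $f(0)=1$. It is identified with the group ring $\mathbb{Z}[\mathbb{C}^\times]$ by $\prod_a(1-at)^{-k_a}\leftrightarrow\sum_a k_a[a]$ (finite sums, $k_a\in\mathbb{Z}$). The Hadamard norm is $\left\|\sum_a k_a[a]\right\|_H=\sum_a|k_a||a|$. An entire function is of genus zero if it is of the form $c z^m\prod_n(1-z/a_n)$ with $c\in\mathbb{C}$, $m\ge 0$, and $(a_n)$ a finite or countable family of non-zero complex numbers with $\sum_n 1/|a_n|<\infty$. A Hadamard function is a meromorphic function on $\mathbb{C}$ that can be written as a quotient $g/h$ with $g,h$ entire functions of genus zero ($h\ne0$). *)

theory Defs
  imports
    "HOL-Complex_Analysis.Complex_Analysis"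
    "HOL-Computational_Algebra.Computational_Algebra"
    "HOL-Computational_Algebra.Field_as_Ring"
begin

text \<open>
  Formal sums of elements \<open>[a]\<close> with \<open>a\<close> a nonzero complex number and integer coefficients
  are represented by their coefficient functions, extended by \<open>0\<close> at \<open>a = 0\<close>.
\<close>

definition group_ring :: "(complex \<Rightarrow> int) set" where
  "group_ring = {k. k 0 = 0 \<and> finite {a. k a \<noteq> 0}}"

definition formal_sums :: "(complex \<Rightarrow> int) set" where
  "formal_sums = {k. k 0 = 0 \<and> (\<lambda>a. of_int \<bar>k a\<bar> * norm a) summable_on (- {0})}"

definition hadamard_norm :: "(complex \<Rightarrow> int) \<Rightarrow> real" where
  "hadamard_norm k = (\<Sum>\<^sub>\<infinity>a\<in>- {0}. of_int \<bar>k a\<bar> * norm a)"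

definition hadamard_dist :: "(complex \<Rightarrow> int) \<Rightarrow> (complex \<Rightarrow> int) \<Rightarrow> real" where
  "hadamard_dist k l = hadamard_norm (\<lambda>a. k a - l a)"

text \<open>
  Meromorphic functions on the complex plane are represented by their normalized
  representatives, i.e. the functions \<open>f\<close> with \<^term>\<open>f nicely_meromorphic_on UNIV\<close>: they have
  value \<open>0\<close> at their poles and no removable singularities, so that equality of meromorphic
  functions is equality of functions.  Evaluating the reduced fraction of a rational function
  gives its normalized representative, since division by \<open>0\<close> yields \<open>0\<close>.  In particular
  the value at a point is \<open>1\<close> only if the point is not a pole.
\<close>

definition rat_eval :: "complex poly fract \<Rightarrow> complex \<Rightarrow> complex" where
  "rat_eval f z = poly (fst (quot_of_fract f)) z / poly (snd (quot_of_fract f)) z"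

definition R1 :: "complex poly fract set" where
  "R1 = {f. rat_eval f 0 = 1}"

definition group_ring_to_R1 :: "(complex \<Rightarrow> int) \<Rightarrow> complex poly fract" where
  "group_ring_to_R1 k = (\<Prod>a | k a \<noteq> 0. to_fract [:1, - a:] powi (- k a))"

definition R1_to_group_ring :: "complex poly fract \<Rightarrow> complex \<Rightarrow> int" where
  "R1_to_group_ring = the_inv_into group_ring group_ring_to_R1"

definition R1_dist :: "complex poly fract \<Rightarrow> complex poly fract \<Rightarrow> real" where
  "R1_dist f g = hadamard_dist (R1_to_group_ring f) (R1_to_group_ring g)"

definition is_completion ::
  "'a set \<Rightarrow> ('a \<Rightarrow> 'a \<Rightarrow> real) \<Rightarrow> 'b set \<Rightarrow> ('b \<Rightarrow> 'b \<Rightarrow> real) \<Rightarrow> ('a \<Rightarrow> 'b) \<Rightarrow> bool" where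
  "is_completion M d M' d' i \<longleftrightarrow>
     Metric_space M d \<and> Metric_space M' d' \<and> Metric_space.mcomplete M' d' \<and>
     i \<in> M \<rightarrow> M' \<and> (\<forall>x\<in>M. \<forall>y\<in>M. d' (i x) (i y) = d x y) \<and>
     Metric_space.mtopology M' d' closure_of (i ` M) = M'"

text \<open>The product of a family, as the limit of the net of its finite subproducts.\<close>

definition family_prod :: "('i \<Rightarrow> complex) \<Rightarrow> 'i set \<Rightarrow> complex" where
  "family_prod f I = Lim (finite_subsets_at_top I) (\<lambda>F. \<Prod>i\<in>F. f i)"

text \<open>The index set \<open>I\<close> of natural numbers is arbitrary: it covers finite and countable families.\<close>

definition genus_zero :: "(complex \<Rightarrow> complex) \<Rightarrow> bool" where
  "genus_zero f \<longleftrightarrow> f holomorphic_on UNIV \<and>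
     (\<exists>(c::complex) (m::nat) (I::nat set) (a::nat \<Rightarrow> complex).
        (\<forall>n\<in>I. a n \<noteq> 0) \<and> (\<lambda>n. 1 / norm (a n)) summable_on I \<and>
        (\<forall>z. f z = c * z ^ m * family_prod (\<lambda>n. 1 - z / a n) I))"

definition hadamard_function :: "(complex \<Rightarrow> complex) \<Rightarrow> bool" where
  "hadamard_function f \<longleftrightarrow> f nicely_meromorphic_on UNIV \<and>
     (\<exists>g h. genus_zero g \<and> genus_zero h \<and> h \<noteq> (\<lambda>_. 0) \<and> (\<forall>z. h z \<noteq> 0 \<longrightarrow> f z = g z / h z))"

definition H1 :: "(complex \<Rightarrow> complex) set" where
  "H1 = {f. hadamard_function f \<and> f 0 = 1}"

definition num_factor :: "(complex \<Rightarrow> int) \<Rightarrow> complex \<Rightarrow> complex \<Rightarrow> complex" where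
  "num_factor k t a = (1 - a * t) ^ nat (- k a)"

definition den_factor :: "(complex \<Rightarrow> int) \<Rightarrow> complex \<Rightarrow> complex \<Rightarrow> complex" where
  "den_factor k t a = (1 - a * t) ^ nat (k a)"

definition hadamard_num :: "(complex \<Rightarrow> int) \<Rightarrow> complex \<Rightarrow> complex" where
  "hadamard_num k t = family_prod (num_factor k t) {a. k a < 0}"

definition hadamard_den :: "(complex \<Rightarrow> int) \<Rightarrow> complex \<Rightarrow> complex" where
  "hadamard_den k t = family_prod (den_factor k t) {a. k a > 0}"

text \<open>
  Numerator and denominator have no common zeros, so that the quotient below, being \<open>0\<close> where
  the denominator vanishes, is the normalized representative of the meromorphic function.
\<close>

definition hadamard_map :: "(complex \<Rightarrow> int) \<Rightarrow> complex \<Rightarrow> complex" where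
  "hadamard_map k t = hadamard_num k t / hadamard_den k t"

end

theory Submission
  imports Defs
begin

text \<open>
  A function of genus zero with value \<open>1\<close> at \<open>0\<close> is determined by the multiplicities
  \<open>m a\<close> of the factors \<open>1 - a t\<close>, and every \<open>m\<close> with \<open>\<Sum>a. m a * \<bar>a\<bar> < \<infinity>\<close> occurs;
  the resulting canonical product turns sums of multiplicities into products, and its zeros are
  those of its factors.  Thus a formal sum \<open>k\<close> yields the quotient of the canonical products of
  \<open>k\<^sup>-\<close> and \<open>k\<^sup>+\<close>, and \<open>k a\<close> is recovered as minus the order of this quotient at
  \<open>1 / a\<close>.  Conversely, in a Hadamard function \<open>g / h\<close> the constant and the power of \<open>z\<close>
  cancel because the value at \<open>0\<close> is \<open>1\<close>, and the factors common to \<open>g\<close> and \<open>h\<close> cancel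
  as well.  Completeness of the space of formal sums holds because a Cauchy sequence of integer
  coefficients is eventually constant at each \<open>a \<noteq> 0\<close>.
\<close>

section \<open>Absolutely convergent products\<close>

lemma eventually_finite_subsets_at_topI:
  assumes "finite X" "X \<subseteq> A" "\<And>Y. finite Y \<Longrightarrow> X \<subseteq> Y \<Longrightarrow> Y \<subseteq> A \<Longrightarrow> P Y"
  shows "eventually P (finite_subsets_at_top A)"
  unfolding eventually_finite_subsets_at_top using assms by (intro exI[of _ X]) simp

text \<open>Bounds of the form \<open>exp w - 1\<close> multiply well:
  \<open>u * v - 1 = u * (v - 1) + (u - 1)\<close> holds for the factors and for the exponentials
  alike, so errors simply add up in the exponent. For infinite \<open>A\<close> both sides are
  0.\<close>

lemma norm_prod_diff_one_le:
  fixes f :: "'i \<Rightarrow> 'a :: {real_normed_div_algebra, comm_ring_1}"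
  assumes "\<And>x. x \<in> A \<Longrightarrow> norm (f x - 1) \<le> exp (w x) - 1"
  shows "norm (prod f A - 1) \<le> exp (sum w A) - 1"
  using assms
proof (induction A rule: infinite_finite_induct)
  case (insert x A)
  have IH: "norm (prod f A - 1) \<le> exp (sum w A) - 1"
    by (intro insert.IH) (use insert.prems in auto)
  have fx: "norm (f x - 1) \<le> exp (w x) - 1" using insert.prems by auto
  have "norm (f x) \<le> norm (f x - 1) + 1"
    using norm_triangle_sub[of "f x" 1] by simp
  hence fx': "norm (f x) \<le> exp (w x)" using fx by simp
  have "prod f (insert x A) - 1 = f x * (prod f A - 1) + (f x - 1)"
    using insert.hyps by (simp add: algebra_simps)
  hence "norm (prod f (insert x A) - 1) \<le> norm (f x) * norm (prod f A - 1) + norm (f x - 1)"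
    by (metis norm_triangle_ineq norm_mult)
  also have "\<dots> \<le> exp (w x) * (exp (sum w A) - 1) + (exp (w x) - 1)"
    using fx fx' IH by (intro add_mono mult_mono) auto
  also have "\<dots> = exp (sum w (insert x A)) - 1"
    using insert.hyps by (simp add: algebra_simps exp_add)
  finally show ?case .
qed simp_all

text \<open>If the sum over \<open>F\<close> is within half of \<open>\<epsilon>\<close> of the
  total, nonnegativity leaves no room for more than that outside \<open>F\<close>.\<close>

lemma summable_on_small_tails:
  fixes w :: "'i \<Rightarrow> real"
  assumes "w summable_on A" "\<And>x. x \<in> A \<Longrightarrow> w x \<ge> 0" "\<epsilon> > 0"
  obtains F where "finite F" "F \<subseteq> A" "\<And>G. finite G \<Longrightarrow> G \<subseteq> A - F \<Longrightarrow> sum w G < \<epsilon>"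
proof -
  obtain F where F: "finite F" "F \<subseteq> A" "dist (sum w F) (infsum w A) \<le> \<epsilon> / 2"
    using infsum_finite_approximation[OF assms(1), of "\<epsilon> / 2"] assms(3) by auto
  have "sum w G < \<epsilon>" if G: "finite G" "G \<subseteq> A - F" for G
  proof -
    have "sum w F + sum w G = sum w (F \<union> G)"
      using F G by (intro sum.union_disjoint[symmetric]) auto
    also have "\<dots> \<le> infsum w A"
      using F G assms by (intro finite_sum_le_infsum) auto
    finally show ?thesis
      using F(3) assms(3) unfolding dist_real_def by (simp add: abs_if split: if_splits)
  qed
  thus ?thesis using F that by blast
qed

text \<open>Beyond a large finite subproduct, all further factors together are close to \<open>1\<close>.\<close>

lemma uniform_limit_family_prod:
  fixes f :: "'t \<Rightarrow> 'i \<Rightarrow> complex"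
  assumes w: "w summable_on A" "\<And>x. x \<in> A \<Longrightarrow> w x \<ge> 0"
    and f: "\<And>t x. t \<in> K \<Longrightarrow> x \<in> A \<Longrightarrow> norm (f t x - 1) \<le> exp (w x) - 1"
  shows "uniform_limit K (\<lambda>F t. \<Prod>x\<in>F. f t x) (\<lambda>t. family_prod (f t) A)
           (finite_subsets_at_top A)"
proof -
  define S where "S = infsum w A"
  have "\<exists>X. finite X \<and> X \<subseteq> A \<and> (\<forall>Y. finite Y \<and> X \<subseteq> Y \<and> Y \<subseteq> A \<longrightarrow>
           (\<forall>t\<in>K. dist (\<Prod>x\<in>Y. f t x) (\<Prod>x\<in>X. f t x) < e))" if "e > 0" for e
  proof -
    \<comment> \<open>Solves \<open>(exp d - 1) * exp S = e\<close>, where \<open>exp S\<close>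
      bounds every finite subproduct and \<open>d\<close> bounds the weight of the remaining
      factors.\<close>
    define d where "d = ln (1 + e / exp S)"
    have "d > 0" using that unfolding d_def by (intro ln_gt_zero) simp
    then obtain F where F: "finite F" "F \<subseteq> A"
      "\<And>G. finite G \<Longrightarrow> G \<subseteq> A - F \<Longrightarrow> sum w G < d"
      using summable_on_small_tails[OF w] by metis
    have "dist (\<Prod>x\<in>Y. f t x) (\<Prod>x\<in>F. f t x) < e"
      if Y: "finite Y" "F \<subseteq> Y" "Y \<subseteq> A" and t: "t \<in> K" for Y t
    proof -
      have "(\<Prod>x\<in>Y. f t x) = (\<Prod>x\<in>Y - F. f t x) * (\<Prod>x\<in>F. f t x)"
        using Y F by (intro prod.subset_diff) auto
      hence "dist (\<Prod>x\<in>Y. f t x) (\<Prod>x\<in>F. f t x) =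
          norm (((\<Prod>x\<in>Y - F. f t x) - 1) * (\<Prod>x\<in>F. f t x))"
        by (simp add: dist_norm algebra_simps)
      also have "\<dots> = norm ((\<Prod>x\<in>Y - F. f t x) - 1) * norm (\<Prod>x\<in>F. f t x)"
        by (rule norm_mult)
      also have "\<dots> \<le> (exp (sum w (Y - F)) - 1) * exp S"
      proof (intro mult_mono)
        show "norm ((\<Prod>x\<in>Y - F. f t x) - 1) \<le> exp (sum w (Y - F)) - 1"
          using Y t by (intro norm_prod_diff_one_le f) auto
        have "norm (\<Prod>x\<in>F. f t x) \<le> norm ((\<Prod>x\<in>F. f t x) - 1) + 1"
          using norm_triangle_sub[of "\<Prod>x\<in>F. f t x" 1] by simp
        also have "norm ((\<Prod>x\<in>F. f t x) - 1) \<le> exp (sum w F) - 1"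
          using F t by (intro norm_prod_diff_one_le f) auto
        hence "norm ((\<Prod>x\<in>F. f t x) - 1) + 1 \<le> exp (sum w F)" by simp
        also have "\<dots> \<le> exp S"
          unfolding S_def using w F by (auto intro!: finite_sum_le_infsum)
        finally show "norm (\<Prod>x\<in>F. f t x) \<le> exp S" .
        show "0 \<le> exp (sum w (Y - F)) - 1" using Y w by (auto intro!: sum_nonneg)
      qed auto
      also have "\<dots> < (exp d - 1) * exp S"
        using F(3)[of "Y - F"] Y by (intro mult_strict_right_mono) auto
      also have "exp d = 1 + e / exp S"
        using \<open>e > 0\<close> by (simp add: d_def add_pos_pos)
      finally show ?thesis by simp
    qed
    thus ?thesis using F(1,2) by blast
  qed note * = this
  \<comment> \<open>\<open>family_prod\<close> is given by \<open>Lim\<close>, so existence of a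
    limit must come first; the Cauchy criterion supplies it pointwise.\<close>
  have ptw: "((\<lambda>F. \<Prod>x\<in>F. f t x) \<longlongrightarrow> family_prod (f t) A) (finite_subsets_at_top A)"
    if t: "t \<in> K" for t
  proof -
    have "cauchy_filter (filtermap (\<lambda>F. \<Prod>x\<in>F. f t x) (finite_subsets_at_top A))"
      unfolding cauchy_filter_metric_filtermap
    proof (intro allI impI)
      fix e :: real assume "e > 0"
      then obtain X where X: "finite X" "X \<subseteq> A"
        "\<And>Y. finite Y \<Longrightarrow> X \<subseteq> Y \<Longrightarrow> Y \<subseteq> A \<Longrightarrow> dist (\<Prod>x\<in>Y. f t x) (\<Prod>x\<in>X. f t x) < e / 2"
        using *[of "e / 2"] t by auto
      let ?P = "\<lambda>Y. finite Y \<and> X \<subseteq> Y \<and> Y \<subseteq> A"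
      have "eventually ?P (finite_subsets_at_top A)"
        using X(1,2) by (intro eventually_finite_subsets_at_topI[of X]) simp_all
      moreover have "dist (\<Prod>x\<in>Y. f t x) (\<Prod>x\<in>Z. f t x) < e" if "?P Y" "?P Z" for Y Z
        by (rule dist_triangle_half_l[OF X(3) X(3)]) (use that in simp_all)
      ultimately show "\<exists>P. eventually P (finite_subsets_at_top A) \<and>
         (\<forall>Y Z. P Y \<and> P Z \<longrightarrow> dist (\<Prod>x\<in>Y. f t x) (\<Prod>x\<in>Z. f t x) < e)"
        by (intro exI[of _ ?P]) simp
    qed
    moreover have "filtermap (\<lambda>F. \<Prod>x\<in>F. f t x) (finite_subsets_at_top A) \<noteq> bot"
      by (simp add: filtermap_bot_iff)
    ultimately obtain l where
      "filtermap (\<lambda>F. \<Prod>x\<in>F. f t x) (finite_subsets_at_top A) \<le> nhds l"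
      using cauchy_filter_complete_converges[OF _ complete_UNIV] by fastforce
    hence "((\<lambda>F. \<Prod>x\<in>F. f t x) \<longlongrightarrow> l) (finite_subsets_at_top A)"
      by (simp add: filterlim_def)
    thus ?thesis unfolding family_prod_def
      by (metis tendsto_Lim finite_subsets_at_top_neq_bot)
  qed
  show ?thesis
  proof (rule uniform_limitI)
    fix e :: real assume "e > 0"
    then obtain X where X: "finite X" "X \<subseteq> A"
      "\<And>Y t. finite Y \<Longrightarrow> X \<subseteq> Y \<Longrightarrow> Y \<subseteq> A \<Longrightarrow> t \<in> K \<Longrightarrow> dist (\<Prod>x\<in>Y. f t x) (\<Prod>x\<in>X. f t x) < e / 3"
      using *[of "e / 3"] by auto
    \<comment> \<open>Passing to the limit weakens the strict bound, but the set \<open>X\<close> is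
      the same for all \<open>t\<close>, which gives uniformity.\<close>
    have lim: "dist (family_prod (f t) A) (\<Prod>x\<in>X. f t x) \<le> e / 3" if "t \<in> K" for t
    proof (rule tendsto_upperbound)
      show "((\<lambda>F. dist (\<Prod>x\<in>F. f t x) (\<Prod>x\<in>X. f t x)) \<longlongrightarrow>
         dist (family_prod (f t) A) (\<Prod>x\<in>X. f t x)) (finite_subsets_at_top A)"
        by (intro tendsto_intros ptw that)
      show "\<forall>\<^sub>F F in finite_subsets_at_top A. dist (\<Prod>x\<in>F. f t x) (\<Prod>x\<in>X. f t x) \<le> e / 3"
        by (rule eventually_finite_subsets_at_topI[OF X(1,2)]) (rule less_imp_le[OF X(3)[OF _ _ _ that]])
    qed auto
    have "dist (\<Prod>x\<in>Y. f t x) (family_prod (f t) A) < e"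
      if "finite Y" "X \<subseteq> Y" "Y \<subseteq> A" "t \<in> K" for Y t
      using X(3)[OF that] lim[OF that(4)] \<open>e > 0\<close>
        dist_triangle[of "\<Prod>x\<in>Y. f t x" "family_prod (f t) A" "\<Prod>x\<in>X. f t x"]
      by (simp add: dist_commute)
    thus "\<forall>\<^sub>F F in finite_subsets_at_top A. \<forall>t\<in>K. dist (\<Prod>x\<in>F. f t x) (family_prod (f t) A) < e"
      using X(1,2) by (intro eventually_finite_subsets_at_topI[of X] ballI) simp_all
  qed
qed

lemma family_prod_tendsto:
  fixes f :: "'i \<Rightarrow> complex"
  assumes "w summable_on A" "\<And>x. x \<in> A \<Longrightarrow> w x \<ge> 0"
    and "\<And>x. x \<in> A \<Longrightarrow> norm (f x - 1) \<le> exp (w x) - 1"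
  shows "((\<lambda>F. \<Prod>x\<in>F. f x) \<longlongrightarrow> family_prod f A) (finite_subsets_at_top A)"
  \<comment> \<open>Pointwise convergence is uniform convergence over a one-point parameter
    set.\<close>
  using tendsto_uniform_limitI[OF uniform_limit_family_prod[of w A "{()}" "\<lambda>_. f"], of "()"] assms
  by auto

lemma family_prod_eqI:
  "((\<lambda>F. \<Prod>x\<in>F. f x) \<longlongrightarrow> l) (finite_subsets_at_top A) \<Longrightarrow> family_prod f A = l"
  unfolding family_prod_def by (metis tendsto_Lim finite_subsets_at_top_neq_bot)

lemma family_prod_nonzero:
  fixes f :: "'i \<Rightarrow> complex"
  assumes w: "w summable_on A" "\<And>x. x \<in> A \<Longrightarrow> w x \<ge> 0"
    and f: "\<And>x. x \<in> A \<Longrightarrow> norm (f x - 1) \<le> exp (w x) - 1"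
    and nz: "\<And>x. x \<in> A \<Longrightarrow> f x \<noteq> 0"
  shows "family_prod f A \<noteq> 0"
proof -
  \<comment> \<open>With tail weight below \<open>ln (3 / 2)\<close>, the remaining factors multiply
    to something within 1/2 of 1. Subproducts beyond \<open>X\<close> therefore keep at least half
    the norm of the nonzero product over \<open>X\<close>, and so does the limit.\<close>
  have "ln (3 / 2 :: real) > 0" by simp
  then obtain X where X: "finite X" "X \<subseteq> A"
    "\<And>G. finite G \<Longrightarrow> G \<subseteq> A - X \<Longrightarrow> sum w G < ln (3 / 2)"
    using summable_on_small_tails[OF w] by metis
  have bound: "norm (\<Prod>x\<in>Y. f x) \<ge> norm (\<Prod>x\<in>X. f x) / 2"
    if Y: "finite Y" "X \<subseteq> Y" "Y \<subseteq> A" for Y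
  proof -
    have "norm ((\<Prod>x\<in>Y - X. f x) - 1) \<le> exp (sum w (Y - X)) - 1"
      using Y by (intro norm_prod_diff_one_le f) auto
    also have "\<dots> \<le> exp (ln (3 / 2)) - 1"
      using less_imp_le[OF X(3)[of "Y - X"]] Y
      by (intro diff_right_mono, subst exp_le_cancel_iff) auto
    finally have "norm ((\<Prod>x\<in>Y - X. f x) - 1) \<le> 1 / 2" by simp
    hence "norm (\<Prod>x\<in>Y - X. f x) \<ge> 1 / 2"
      using norm_triangle_ineq2[of 1 "1 - (\<Prod>x\<in>Y - X. f x)"] by (simp add: norm_minus_commute)
    moreover have "(\<Prod>x\<in>Y. f x) = (\<Prod>x\<in>Y - X. f x) * (\<Prod>x\<in>X. f x)"
      using Y X by (intro prod.subset_diff) auto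
    ultimately show ?thesis
      using mult_right_mono[of "1 / 2" "norm (\<Prod>x\<in>Y - X. f x)" "norm (\<Prod>x\<in>X. f x)"]
      by (simp add: norm_mult)
  qed
  have "norm (family_prod f A) \<ge> norm (\<Prod>x\<in>X. f x) / 2"
  proof (rule tendsto_lowerbound)
    show "((\<lambda>F. norm (\<Prod>x\<in>F. f x)) \<longlongrightarrow> norm (family_prod f A)) (finite_subsets_at_top A)"
      by (intro tendsto_norm family_prod_tendsto[of w] w f)
    show "\<forall>\<^sub>F F in finite_subsets_at_top A. norm (\<Prod>x\<in>X. f x) / 2 \<le> norm (\<Prod>x\<in>F. f x)"
      by (intro eventually_finite_subsets_at_topI[of X] X bound)
  qed auto
  moreover have "norm (\<Prod>x\<in>X. f x) > 0" using X nz by (auto simp: prod_zero_iff)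
  ultimately show ?thesis by auto
qed

text \<open>Turns a net over finite subsets of \<open>A\<close> into one over finite subsets of
  \<open>B\<close> that ignores indices outside \<open>A\<close>; this puts products over different
  index sets on a common net.\<close>

lemma filterlim_inter_finite_subsets_at_top:
  assumes "A \<subseteq> B"
  shows "filterlim (\<lambda>F. F \<inter> A) (finite_subsets_at_top A) (finite_subsets_at_top B)"
  unfolding filterlim_finite_subsets_at_top eventually_finite_subsets_at_top
  using assms by blast

section \<open>Canonical products of genus zero\<close>

text \<open>Indexed by all complex \<open>a\<close>, with factor 1 where \<open>m a = 0\<close>, so
  that products for different \<open>m\<close> run along one net and multiply termwise.\<close>

definition canonical_product :: "(complex \<Rightarrow> nat) \<Rightarrow> complex \<Rightarrow> complex" where
  "canonical_product m t = family_prod (\<lambda>a. (1 - a * t) ^ m a) UNIV"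

text \<open>Since \<open>a\<close> is the reciprocal of a zero, this is the genus zero condition on
  the zeros, counted with multiplicity.\<close>

definition summable_weight :: "(complex \<Rightarrow> nat) \<Rightarrow> bool" where
  "summable_weight m \<longleftrightarrow> (\<lambda>a. real (m a) * norm a) summable_on UNIV"

lemma summable_weight_mono:
  assumes "summable_weight n" "\<And>a. m a \<le> n a"
  shows "summable_weight m"
  unfolding summable_weight_def
proof (rule summable_on_comparison_test)
  show "(\<lambda>a. real (n a) * norm a) summable_on UNIV"
    using assms(1) by (simp add: summable_weight_def)
  show "real (m a) * norm a \<le> real (n a) * norm a" for a
    using assms(2)[of a] by (intro mult_right_mono) simp_all
qed simp

text \<open>Combines \<open>x \<le> exp x - 1\<close> for one factor with the product estimate for
  \<open>n\<close> equal factors. The bound depends on \<open>t\<close> only through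
  \<open>R\<close>, whence uniform convergence on bounded sets.\<close>

lemma norm_linear_factor_power_le:
  fixes a t :: complex
  assumes "norm t \<le> R"
  shows "norm ((1 - a * t) ^ n - 1) \<le> exp (R * (real n * norm a)) - 1"
proof -
  have "norm ((1 - a * t) - 1) \<le> exp (R * norm a) - 1"
  proof -
    have "norm ((1 - a * t) - 1) = norm a * norm t" by (simp add: norm_mult)
    also have "\<dots> \<le> norm a * R" using assms by (intro mult_left_mono) auto
    also have "\<dots> \<le> exp (norm a * R) - 1" using exp_ge_add_one_self[of "norm a * R"] by linarith
    finally show ?thesis by (simp add: mult.commute)
  qed
  from norm_prod_diff_one_le[of "{..<n}" "\<lambda>_. 1 - a * t" "\<lambda>_. R * norm a", OF this]
  show ?thesis by (simp add: mult_ac)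
qed

lemma canonical_product_tendsto:
  assumes "summable_weight m"
  shows "((\<lambda>F. \<Prod>a\<in>F. (1 - a * t) ^ m a) \<longlongrightarrow> canonical_product m t) finite_sets_at_top"
  unfolding canonical_product_def
proof (rule family_prod_tendsto)
  show "(\<lambda>a. norm t * (real (m a) * norm a)) summable_on UNIV"
    using assms unfolding summable_weight_def by (rule summable_on_cmult_right)
qed (auto intro: norm_linear_factor_power_le)

lemma canonical_product_eqI:
  "((\<lambda>F. \<Prod>a\<in>F. (1 - a * t) ^ m a) \<longlongrightarrow> l) finite_sets_at_top \<Longrightarrow> canonical_product m t = l"
  unfolding canonical_product_def by (rule family_prod_eqI)

text \<open>Factors with \<open>m a = 0\<close> equal 1, so restricting the full net to
  \<open>A\<close> changes no finite subproduct.\<close>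

lemma family_prod_support:
  assumes m: "summable_weight m" and A: "\<And>a. m a \<noteq> 0 \<Longrightarrow> a \<in> A"
  shows "family_prod (\<lambda>a. (1 - a * t) ^ m a) A = canonical_product m t"
proof -
  have "((\<lambda>F. \<Prod>a\<in>F. (1 - a * t) ^ m a) \<longlongrightarrow> family_prod (\<lambda>a. (1 - a * t) ^ m a) A)
      (finite_subsets_at_top A)"
  proof (rule family_prod_tendsto)
    show "(\<lambda>a. norm t * (real (m a) * norm a)) summable_on A"
      using m unfolding summable_weight_def
      by (intro summable_on_cmult_right) (rule summable_on_subset[OF _ subset_UNIV])
  qed (auto intro: norm_linear_factor_power_le)
  hence "((\<lambda>F. \<Prod>a\<in>F \<inter> A. (1 - a * t) ^ m a) \<longlongrightarrow> family_prod (\<lambda>a. (1 - a * t) ^ m a) A)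
      finite_sets_at_top"
    by (rule filterlim_compose[OF _ filterlim_inter_finite_subsets_at_top]) auto
  hence "((\<lambda>F. \<Prod>a\<in>F. (1 - a * t) ^ m a) \<longlongrightarrow> family_prod (\<lambda>a. (1 - a * t) ^ m a) A)
      finite_sets_at_top"
  proof (rule Lim_transform_eventually, intro eventually_finite_subsets_at_top_weakI)
    fix F :: "complex set" assume "finite F"
    moreover have "(1 - a * t) ^ m a = 1" if "a \<notin> A" for a
      using A[of a] that by (cases "m a = 0") auto
    ultimately show "(\<Prod>a\<in>F \<inter> A. (1 - a * t) ^ m a) = (\<Prod>a\<in>F. (1 - a * t) ^ m a)"
      by (intro prod.mono_neutral_left) auto
  qed
  thus ?thesis by (rule canonical_product_eqI[symmetric])
qed

lemma uniform_limit_canonical_product: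
  assumes m: "summable_weight m" and A: "\<And>a. m a \<noteq> 0 \<Longrightarrow> a \<in> A" and K: "bounded K"
  shows "uniform_limit K (\<lambda>F t. \<Prod>a\<in>F. (1 - a * t) ^ m a) (canonical_product m)
           (finite_subsets_at_top A)"
proof -
  obtain R where R: "R > 0" "\<And>t. t \<in> K \<Longrightarrow> norm t \<le> R"
    using K by (meson bounded_pos)
  have "uniform_limit K (\<lambda>F t. \<Prod>a\<in>F. (1 - a * t) ^ m a)
      (\<lambda>t. family_prod (\<lambda>a. (1 - a * t) ^ m a) A) (finite_subsets_at_top A)"
  proof (rule uniform_limit_family_prod)
    show "(\<lambda>a. R * (real (m a) * norm a)) summable_on A"
      using m unfolding summable_weight_def
      by (intro summable_on_cmult_right) (rule summable_on_subset[OF _ subset_UNIV])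
  qed (use R in \<open>auto intro: norm_linear_factor_power_le\<close>)
  thus ?thesis using family_prod_support[OF m A] by simp
qed

text \<open>Holomorphy is local, and on a ball around each point the product is a uniform limit of
  polynomials in \<open>t\<close>.\<close>

lemma holomorphic_canonical_product:
  assumes "summable_weight m"
  shows "canonical_product m holomorphic_on S"
proof -
  have "canonical_product m field_differentiable at z" for z
  proof -
    have "canonical_product m holomorphic_on ball z 1"
    proof (rule holomorphic_uniform_limit)
      show "uniform_limit (cball z 1) (\<lambda>F t. \<Prod>a\<in>F. (1 - a * t) ^ m a) (canonical_product m)
          finite_sets_at_top"
        using assms by (intro uniform_limit_canonical_product) auto
      show "\<forall>\<^sub>F F in finite_sets_at_top. continuous_on (cball z 1) (\<lambda>t. \<Prod>a\<in>F. (1 - a * t) ^ m a) \<and>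
          (\<lambda>t. \<Prod>a\<in>F. (1 - a * t) ^ m a) holomorphic_on ball z 1"
        by (intro always_eventually allI conjI continuous_intros holomorphic_intros)
    qed auto
    thus ?thesis by (auto simp: holomorphic_on_open field_differentiable_def)
  qed
  thus ?thesis
    by (simp add: holomorphic_on_def field_differentiable_at_within)
qed

lemma canonical_product_add:
  assumes "summable_weight m" "summable_weight n"
  shows "canonical_product (\<lambda>a. m a + n a) t = canonical_product m t * canonical_product n t"
proof (rule canonical_product_eqI)
  show "((\<lambda>F. \<Prod>a\<in>F. (1 - a * t) ^ (m a + n a)) \<longlongrightarrow>
      canonical_product m t * canonical_product n t) finite_sets_at_top"
    using tendsto_mult[OF canonical_product_tendsto[OF assms(1)] canonical_product_tendsto[OF assms(2)]]
    by (simp add: power_add prod.distrib)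
qed

lemma canonical_product_finite:
  assumes "finite S" "\<And>a. a \<notin> S \<Longrightarrow> m a = 0"
  shows "canonical_product m t = (\<Prod>a\<in>S. (1 - a * t) ^ m a)"
proof (rule canonical_product_eqI[OF tendsto_eventually])
  show "\<forall>\<^sub>F F in finite_sets_at_top. (\<Prod>a\<in>F. (1 - a * t) ^ m a) = (\<Prod>a\<in>S. (1 - a * t) ^ m a)"
    using assms by (intro eventually_finite_subsets_at_topI[of S] prod.mono_neutral_right) auto
qed

lemma canonical_product_at_0 [simp]: "canonical_product m 0 = 1"
  by (rule canonical_product_eqI) simp

text \<open>Writes \<open>m\<close> as a part concentrated at \<open>a\<close> plus the rest. This
  isolates the only factor that can vanish at \<open>1 / a\<close>, as needed for zeros and
  orders.\<close>

lemma canonical_product_remove: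
  assumes "summable_weight m"
  shows "canonical_product m t = (1 - a * t) ^ m a * canonical_product (m(a := 0)) t"
proof -
  let ?s = "\<lambda>x. if x = a then m a else 0"
  have s: "canonical_product ?s t = (1 - a * t) ^ m a"
    by (subst canonical_product_finite[of "{a}"]) auto
  have "summable_weight ?s" "summable_weight (m(a := 0))"
    by (rule summable_weight_mono[OF assms], simp)+
  from canonical_product_add[OF this, of t] have
    "canonical_product (\<lambda>x. ?s x + (m(a := 0)) x) t = (1 - a * t) ^ m a * canonical_product (m(a := 0)) t"
    by (simp only: s)
  also have "(\<lambda>x. ?s x + (m(a := 0)) x) = m" by auto
  finally show ?thesis .
qed

lemma canonical_product_eq_0_iff:
  assumes "summable_weight m"
  shows "canonical_product m t = 0 \<longleftrightarrow> (\<exists>a. m a \<noteq> 0 \<and> a * t = 1)"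
proof
  assume "\<exists>a. m a \<noteq> 0 \<and> a * t = 1"
  then obtain a where "m a \<noteq> 0" "a * t = 1" by blast
  thus "canonical_product m t = 0"
    using canonical_product_remove[OF assms, of t a] by simp
next
  assume *: "canonical_product m t = 0"
  show "\<exists>a. m a \<noteq> 0 \<and> a * t = 1"
  proof (rule ccontr)
    assume "\<nexists>a. m a \<noteq> 0 \<and> a * t = 1"
    hence "m a = 0 \<or> 1 - a * t \<noteq> 0" for a by auto
    hence nz: "(1 - a * t) ^ m a \<noteq> 0" for a by (metis power_0 power_not_zero one_neq_zero)
    have "canonical_product m t \<noteq> 0"
      unfolding canonical_product_def
    proof (rule family_prod_nonzero)
      show "(\<lambda>a. norm t * (real (m a) * norm a)) summable_on UNIV"
        using assms unfolding summable_weight_def by (rule summable_on_cmult_right)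
    qed (use nz in \<open>auto intro: norm_linear_factor_power_le\<close>)
    with * show False by simp
  qed
qed

section \<open>Passage between indexed families and multiplicity functions\<close>

lemma finite_fibre:
  fixes b :: "'i \<Rightarrow> complex"
  assumes "(\<lambda>i. norm (b i)) summable_on I" "a \<noteq> 0"
  shows "finite {i \<in> I. b i = a}"
proof -
  \<comment> \<open>A single index outside \<open>F\<close> with value \<open>a\<close> would
    already exceed this tail bound.\<close>
  obtain F where F: "finite F" "\<And>G. finite G \<Longrightarrow> G \<subseteq> I - F \<Longrightarrow> (\<Sum>i\<in>G. norm (b i)) < norm a"
    using summable_on_small_tails[OF assms(1) norm_ge_zero, of "norm a"] assms(2) zero_less_norm_iff
    by metis
  have "i \<in> F" if "i \<in> I" "b i = a" for i
    using F(2)[of "{i}"] that by auto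
  thus ?thesis by (intro finite_subset[OF _ F(1)]) auto
qed

lemma summable_on_iff_summable_weight:
  fixes b :: "'i \<Rightarrow> complex"
  assumes fin: "\<And>a. finite {i \<in> I. b i = a}"
  shows "(\<lambda>i. norm (b i)) summable_on I \<longleftrightarrow> summable_weight (\<lambda>a. card {i \<in> I. b i = a})"
proof -
  have "(\<lambda>i. norm (b i)) summable_on (\<Union>a\<in>UNIV. {i \<in> I. b i = a}) \<longleftrightarrow>
      (\<lambda>a. real (card {i \<in> I. b i = a}) * norm a) summable_on UNIV"
    by (intro summable_on_Union_iff has_sum_finiteI fin) (auto simp: disjoint_family_on_def)
  also have "(\<Union>a\<in>UNIV. {i \<in> I. b i = a}) = I" by auto
  finally show ?thesis by (simp add: summable_weight_def)
qed

text \<open>A finite set of values pulls back along \<open>b\<close> to a finite set of indices, and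
  these preimages exhaust \<open>I\<close>. Grouping each such subproduct by value gives the
  subproduct of the canonical product.\<close>

lemma family_prod_eq_canonical_product:
  fixes b :: "'i \<Rightarrow> complex"
  assumes b: "(\<lambda>i. norm (b i)) summable_on I" and fin: "\<And>a. finite {i \<in> I. b i = a}"
  shows "family_prod (\<lambda>i. 1 - b i * t) I = canonical_product (\<lambda>a. card {i \<in> I. b i = a}) t"
proof (rule canonical_product_eqI[symmetric])
  have "((\<lambda>F. \<Prod>i\<in>F. 1 - b i * t) \<longlongrightarrow> family_prod (\<lambda>i. 1 - b i * t) I) (finite_subsets_at_top I)"
  proof (rule family_prod_tendsto)
    show "(\<lambda>i. norm t * norm (b i)) summable_on I"
      using b by (rule summable_on_cmult_right)
    show "norm (1 - b i * t - 1) \<le> exp (norm t * norm (b i)) - 1" for i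
      using norm_linear_factor_power_le[of t "norm t" "b i" 1] by simp
  qed auto
  moreover have "filterlim (\<lambda>F. {i \<in> I. b i \<in> F}) (finite_subsets_at_top I) finite_sets_at_top"
    unfolding filterlim_finite_subsets_at_top
  proof (intro allI impI)
    fix X assume X: "finite X \<and> X \<subseteq> I"
    have "{i \<in> I. b i \<in> F} = (\<Union>a\<in>F. {i \<in> I. b i = a})" for F by auto
    hence "finite {i \<in> I. b i \<in> F}" if "finite F" for F using fin that by simp
    thus "\<forall>\<^sub>F F in finite_sets_at_top. finite {i \<in> I. b i \<in> F} \<and> X \<subseteq> {i \<in> I. b i \<in> F} \<and>
        {i \<in> I. b i \<in> F} \<subseteq> I"
      using X by (intro eventually_finite_subsets_at_topI[of "b ` X"]) auto
  qed
  ultimately have "((\<lambda>F. \<Prod>i | i \<in> I \<and> b i \<in> F. 1 - b i * t) \<longlongrightarrow> family_prod (\<lambda>i. 1 - b i * t) I)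
      finite_sets_at_top"
    by (rule filterlim_compose)
  thus "((\<lambda>F. \<Prod>a\<in>F. (1 - a * t) ^ card {i \<in> I. b i = a}) \<longlongrightarrow> family_prod (\<lambda>i. 1 - b i * t) I)
      finite_sets_at_top"
  proof (rule Lim_transform_eventually, intro eventually_finite_subsets_at_top_weakI)
    fix F :: "complex set" assume F: "finite F"
    let ?J = "{i \<in> I. b i \<in> F}"
    have "?J = (\<Union>a\<in>F. {i \<in> I. b i = a})" by auto
    hence "finite ?J" using fin F by simp
    hence "(\<Prod>i\<in>?J. 1 - b i * t) = (\<Prod>a\<in>F. \<Prod>i | i \<in> ?J \<and> b i = a. 1 - b i * t)"
      using F by (intro prod.group[symmetric]) auto
    also have "\<dots> = (\<Prod>a\<in>F. (1 - a * t) ^ card {i \<in> I. b i = a})"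
    proof (rule prod.cong)
      fix a assume "a \<in> F"
      hence "{i. i \<in> ?J \<and> b i = a} = {i \<in> I. b i = a}" by auto
      thus "(\<Prod>i | i \<in> ?J \<and> b i = a. 1 - b i * t) = (1 - a * t) ^ card {i \<in> I. b i = a}"
        by simp
    qed simp
    finally show "(\<Prod>i\<in>?J. 1 - b i * t) = (\<Prod>a\<in>F. (1 - a * t) ^ card {i \<in> I. b i = a})" .
  qed
qed

text \<open>\<open>genus_zero\<close> wants a family indexed by natural numbers: each
  \<open>a\<close> is repeated as pairs \<open>(a, j)\<close> with \<open>j < m a\<close>, and these
  countably many pairs are coded by \<open>to_nat_on\<close>.\<close>

lemma enumerate_multiplicities:
  assumes m: "summable_weight m" and m0: "m 0 = 0"
  obtains I :: "nat set" and b :: "nat \<Rightarrow> complex"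
  where "\<And>a. finite {i \<in> I. b i = a}" "\<And>a. card {i \<in> I. b i = a} = m a"
proof -
  define P where "P = (SIGMA a:{a. m a \<noteq> 0}. {..<m a})"
  have "countable {a \<in> UNIV. real (m a) * norm a \<noteq> 0}"
    using m unfolding summable_weight_def by (rule summable_countable_real)
  moreover have "{a \<in> UNIV. real (m a) * norm a \<noteq> 0} = {a. m a \<noteq> 0}"
    using m0 by auto
  ultimately have P: "countable P"
    unfolding P_def by (intro countable_SIGMA) auto
  define I where "I = to_nat_on P ` P"
  define b where "b = (\<lambda>i. fst (from_nat_into P i))"
  have eq: "{i \<in> I. b i = a} = to_nat_on P ` ({a} \<times> {..<m a})" for a
  proof -
    have "b (to_nat_on P p) = fst p" if "p \<in> P" for p
      using P that by (simp add: b_def)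
    hence "{i \<in> I. b i = a} = to_nat_on P ` {p \<in> P. fst p = a}"
      unfolding I_def by auto
    also have "{p \<in> P. fst p = a} = {a} \<times> {..<m a}"
      by (auto simp: P_def)
    finally show ?thesis .
  qed
  have "finite {i \<in> I. b i = a}" for a unfolding eq by simp
  moreover have "card {i \<in> I. b i = a} = m a" for a
  proof -
    have "inj_on (to_nat_on P) ({a} \<times> {..<m a})"
      by (rule inj_on_subset[OF inj_on_to_nat_on[OF P]]) (auto simp: P_def)
    thus ?thesis unfolding eq by (simp add: card_image)
  qed
  ultimately show ?thesis using that by blast
qed

lemma genus_zero_canonical_product:
  assumes m: "summable_weight m" and m0: "m 0 = 0"
  shows "genus_zero (canonical_product m)"
proof -
  obtain I :: "nat set" and b where Ib: "\<And>a. finite {i \<in> I. b i = a}" "\<And>a. card {i \<in> I. b i = a} = m a"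
    using enumerate_multiplicities[OF assms] by blast
  have m_eq: "(\<lambda>a. card {i \<in> I. b i = a}) = m" using Ib(2) by auto
  have summ: "(\<lambda>i. norm (b i)) summable_on I"
    using summable_on_iff_summable_weight[OF Ib(1)] m m_eq by simp
  \<comment> \<open>The fibre over 0 has cardinality \<open>m 0 = 0\<close>; being finite, it is
    empty.\<close>
  have nz: "b i \<noteq> 0" if "i \<in> I" for i
    using Ib(1)[of 0] Ib(2)[of 0] m0 that by auto
  have "canonical_product m z = 1 * z ^ 0 * family_prod (\<lambda>i. 1 - z / (1 / b i)) I" for z
    using family_prod_eq_canonical_product[OF summ Ib(1), of z] by (simp add: m_eq mult.commute)
  moreover have "(\<lambda>i. 1 / norm (1 / b i)) summable_on I"
    using summ by (simp add: norm_divide)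
  moreover have "\<forall>i\<in>I. 1 / b i \<noteq> 0" using nz by auto
  ultimately show ?thesis
    unfolding genus_zero_def using holomorphic_canonical_product[OF m]
    by (intro conjI exI[of _ 1] exI[of _ "0::nat"] exI[of _ I] exI[of _ "\<lambda>i. 1 / b i"]) auto
qed

text \<open>The multiplicity of \<open>a\<close> is the number of indices whose zero is
  \<open>1 / a\<close>, finite because the reciprocals of the zeros are absolutely summable.\<close>

lemma genus_zero_imp_canonical_product:
  assumes "genus_zero g"
  obtains c N m where "summable_weight m" "m 0 = 0" "\<And>z. g z = c * z ^ N * canonical_product m z"
proof -
  obtain c N I and a :: "nat \<Rightarrow> complex" where I: "\<And>n. n \<in> I \<Longrightarrow> a n \<noteq> 0"
    "(\<lambda>n. 1 / norm (a n)) summable_on I"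
    "\<And>z. g z = c * z ^ N * family_prod (\<lambda>n. 1 - z / a n) I"
    using assms unfolding genus_zero_def by blast
  define b where "b = (\<lambda>n. 1 / a n)"
  have summ: "(\<lambda>i. norm (b i)) summable_on I"
    using I(2) by (simp add: b_def norm_divide)
  have empty: "{i \<in> I. b i = 0} = {}" using I(1) by (auto simp: b_def)
  have fin: "finite {i \<in> I. b i = z}" for z
  proof (cases "z = 0")
    case True
    thus ?thesis by (simp only: empty finite.emptyI)
  qed (rule finite_fibre[OF summ])
  show ?thesis
  proof (rule that)
    show "summable_weight (\<lambda>z. card {i \<in> I. b i = z})"
      using summable_on_iff_summable_weight[OF fin] summ by simp
    show "card {i \<in> I. b i = 0} = 0" unfolding empty by simp
    show "g z = c * z ^ N * canonical_product (\<lambda>z. card {i \<in> I. b i = z}) z" for z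
      using family_prod_eq_canonical_product[OF summ fin, of z] I(3)[of z] by (simp add: b_def)
  qed
qed

section \<open>The completion of the group ring\<close>

lemma formal_sums_iff:
  "k \<in> formal_sums \<longleftrightarrow> k 0 = 0 \<and> (\<lambda>a. of_int \<bar>k a\<bar> * norm a) summable_on (- {0})"
  by (simp add: formal_sums_def)

lemma group_ring_subset_formal_sums: "group_ring \<subseteq> formal_sums"
proof
  fix k assume k: "k \<in> group_ring"
  have "(\<lambda>a. of_int \<bar>k a\<bar> * norm a) summable_on (- {0})"
    by (rule finite_nonzero_values_imp_summable_on, rule finite_subset[of _ "{a. k a \<noteq> 0}"])
       (use k in \<open>auto simp: group_ring_def\<close>)
  thus "k \<in> formal_sums" using k by (simp add: formal_sums_iff group_ring_def)
qed

text \<open>Stated for any \<open>m\<close> dominated by the absolute coefficients, so that it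
  serves both positive and negative parts. The term at \<open>a = 0\<close> is 0, hence the step
  from \<open>- {0}\<close> to \<open>UNIV\<close>.\<close>

lemma formal_sums_summable_weight:
  assumes "k \<in> formal_sums" "\<And>a. real (m a) \<le> of_int \<bar>k a\<bar>"
  shows "summable_weight m"
proof -
  have "(\<lambda>a. real (m a) * norm a) summable_on (- {0})"
  proof (rule summable_on_comparison_test)
    show "(\<lambda>a. of_int \<bar>k a\<bar> * norm a) summable_on (- {0})"
      using assms(1) by (simp add: formal_sums_iff)
    show "real (m a) * norm a \<le> of_int \<bar>k a\<bar> * norm a" for a
      using assms(2) by (intro mult_right_mono) simp_all
  qed simp
  also have "(\<lambda>a. real (m a) * norm a) summable_on (- {0}) \<longleftrightarrow> (\<lambda>a. real (m a) * norm a) summable_on UNIV"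
    by (rule summable_on_cong_neutral) auto
  finally show ?thesis by (simp add: summable_weight_def)
qed

lemma summable_weights_formal_sums:
  assumes "summable_weight m" "summable_weight n" "m 0 = n 0"
  shows "(\<lambda>a. int (m a) - int (n a)) \<in> formal_sums"
proof -
  have "(\<lambda>a. of_int \<bar>int (m a) - int (n a)\<bar> * norm a) summable_on (- {0})"
  proof (rule summable_on_comparison_test)
    have "(\<lambda>a. real (m a) * norm a + real (n a) * norm a) summable_on UNIV"
      using assms(1,2) unfolding summable_weight_def by (rule summable_on_add)
    thus "(\<lambda>a. real (m a) * norm a + real (n a) * norm a) summable_on (- {0})"
      by (rule summable_on_subset) auto
    show "of_int \<bar>int (m a) - int (n a)\<bar> * norm a \<le> real (m a) * norm a + real (n a) * norm a" for a
      unfolding distrib_right[symmetric] by (intro mult_right_mono) auto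
  qed simp
  thus ?thesis using assms(3) by (simp add: formal_sums_iff)
qed

lemma formal_sums_diff:
  assumes "k \<in> formal_sums" "l \<in> formal_sums"
  shows "(\<lambda>a. k a - l a) \<in> formal_sums"
proof -
  have "(\<lambda>a. of_int \<bar>k a - l a\<bar> * norm a) summable_on (- {0})"
  proof (rule summable_on_comparison_test)
    show "(\<lambda>a. of_int \<bar>k a\<bar> * norm a + of_int \<bar>l a\<bar> * norm a) summable_on (- {0})"
      using assms unfolding formal_sums_iff by (intro summable_on_add) auto
    show "of_int \<bar>k a - l a\<bar> * norm a \<le> of_int \<bar>k a\<bar> * norm a + of_int \<bar>l a\<bar> * norm a" for a
      unfolding distrib_right[symmetric] by (intro mult_right_mono) auto
  qed simp
  thus ?thesis using assms by (simp add: formal_sums_iff)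
qed

lemma sum_le_hadamard_norm:
  assumes "k \<in> formal_sums" "finite F" "F \<subseteq> - {0}"
  shows "(\<Sum>a\<in>F. of_int \<bar>k a\<bar> * norm a) \<le> hadamard_norm k"
  unfolding hadamard_norm_def using assms
  by (intro finite_sum_le_infsum) (auto simp: formal_sums_iff)

lemma le_hadamard_norm:
  assumes "k \<in> formal_sums"
  shows "of_int \<bar>k a\<bar> * norm a \<le> hadamard_norm k"
proof (cases "a = 0")
  case True
  thus ?thesis by (auto simp: hadamard_norm_def intro!: infsum_nonneg)
next
  case False
  thus ?thesis using sum_le_hadamard_norm[OF assms, of "{a}"] by simp
qed

text \<open>Since the coefficients are integers, small distance forces equality in any fixed coordinate.\<close>

lemma coefficient_eq_if_close:
  assumes "k \<in> formal_sums" "l \<in> formal_sums" "hadamard_dist k l < norm a"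
  shows "k a = l a"
proof (rule ccontr)
  assume "k a \<noteq> l a"
  hence "1 \<le> (of_int \<bar>k a - l a\<bar> :: real)" by linarith
  hence "1 * norm a \<le> of_int \<bar>k a - l a\<bar> * norm a" by (intro mult_right_mono) auto
  also have "\<dots> \<le> hadamard_dist k l"
    unfolding hadamard_dist_def using le_hadamard_norm[OF formal_sums_diff[OF assms(1,2)]] .
  finally show False using assms(3) by simp
qed

interpretation hadamard: Metric_space formal_sums hadamard_dist
proof
  show "0 \<le> hadamard_dist k l" for k l
    by (auto simp: hadamard_dist_def hadamard_norm_def intro!: infsum_nonneg)
  show "hadamard_dist k l = hadamard_dist l k" for k l
    by (simp add: hadamard_dist_def hadamard_norm_def abs_minus_commute)
next
  fix k l assume kl: "k \<in> formal_sums" "l \<in> formal_sums"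
  show "hadamard_dist k l = 0 \<longleftrightarrow> k = l"
  proof
    assume 0: "hadamard_dist k l = 0"
    show "k = l"
    proof
      \<comment> \<open>Distance 0 is below \<open>norm a\<close> for each nonzero \<open>a\<close>;
        at 0 both coefficients vanish by the encoding.\<close>
      fix a show "k a = l a"
        using coefficient_eq_if_close[OF kl, of a] kl 0
        by (cases "a = 0") (auto simp: formal_sums_iff)
    qed
  qed (simp add: hadamard_dist_def hadamard_norm_def)
next
  fix k l m assume klm: "k \<in> formal_sums" "l \<in> formal_sums" "m \<in> formal_sums"
  let ?f = "\<lambda>k l a. of_int \<bar>k a - l a\<bar> * norm (a :: complex) :: real"
  have summ: "?f k l summable_on (- {0})" "?f l m summable_on (- {0})" "?f k m summable_on (- {0})"
    using formal_sums_diff klm by (auto simp: formal_sums_iff)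
  have "infsum (?f k m) (- {0}) \<le> infsum (\<lambda>a. ?f k l a + ?f l m a) (- {0})"
  proof (rule infsum_mono)
    show "?f k m a \<le> ?f k l a + ?f l m a" for a
      unfolding distrib_right[symmetric] by (intro mult_right_mono) auto
  qed (use summ in \<open>auto intro: summable_on_add\<close>)
  also have "\<dots> = infsum (?f k l) (- {0}) + infsum (?f l m) (- {0})"
    using summ by (intro infsum_add)
  finally show "hadamard_dist k m \<le> hadamard_dist k l + hadamard_dist l m"
    by (simp add: hadamard_dist_def hadamard_norm_def)
qed

text \<open>Bounded finite partial sums give summability and the norm bound together, which suits a
  limit not yet known to be a formal sum.\<close>

lemma hadamard_norm_leI:
  assumes "k 0 = 0"
    and "\<And>F. finite F \<Longrightarrow> F \<subseteq> - {0} \<Longrightarrow> (\<Sum>a\<in>F. of_int \<bar>k a\<bar> * norm a) \<le> e"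
  shows "k \<in> formal_sums" "hadamard_norm k \<le> e"
proof -
  have summ: "(\<lambda>a. of_int \<bar>k a\<bar> * norm a) summable_on (- {0})"
    by (rule nonneg_bdd_above_summable_on) (use assms(2) in \<open>auto intro!: bdd_aboveI\<close>)
  thus "k \<in> formal_sums" using assms(1) by (simp add: formal_sums_iff)
  show "hadamard_norm k \<le> e"
    unfolding hadamard_norm_def using summ assms(2) by (intro infsum_le_finite_sums)
qed

lemma mcomplete_formal_sums: "hadamard.mcomplete"
  unfolding hadamard.mcomplete_def
proof (intro allI impI)
  fix \<sigma> assume "hadamard.MCauchy \<sigma>"
  hence \<sigma>: "\<And>n. \<sigma> n \<in> formal_sums"
    "\<And>e. e > 0 \<Longrightarrow> \<exists>N. \<forall>n n'. N \<le> n \<longrightarrow> N \<le> n' \<longrightarrow> hadamard_dist (\<sigma> n) (\<sigma> n') < e"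
    by (auto simp: hadamard.MCauchy_def)
  have "\<exists>c. eventually (\<lambda>n. \<sigma> n a = c) sequentially" for a
  proof (cases "a = 0")
    case True
    thus ?thesis using \<sigma>(1) by (auto simp: formal_sums_iff)
  next
    case False
    then obtain N where N: "\<And>n n'. N \<le> n \<Longrightarrow> N \<le> n' \<Longrightarrow> hadamard_dist (\<sigma> n) (\<sigma> n') < norm a"
      using \<sigma>(2)[of "norm a"] by auto
    have "\<sigma> n a = \<sigma> N a" if "n \<ge> N" for n
      using coefficient_eq_if_close[OF \<sigma>(1) \<sigma>(1) N[OF that order_refl]] .
    thus ?thesis unfolding eventually_sequentially by blast
  qed
  then obtain l where l: "\<And>a. eventually (\<lambda>n. \<sigma> n a = l a) sequentially" by metis
  have l0: "l 0 = 0"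
    using eventually_happens'[OF _ l[of 0]] \<sigma>(1) by (auto simp: formal_sums_iff)
  have close: "(\<lambda>a. \<sigma> n a - l a) \<in> formal_sums \<and> hadamard_dist (\<sigma> n) l \<le> e"
    if N: "\<And>n n'. N \<le> n \<Longrightarrow> N \<le> n' \<Longrightarrow> hadamard_dist (\<sigma> n) (\<sigma> n') < e" and n: "N \<le> n" for N n e
  proof -
    have bound: "(\<Sum>a\<in>F. of_int \<bar>\<sigma> n a - l a\<bar> * norm a) \<le> e" if F: "finite F" "F \<subseteq> - {0}" for F
    proof -
      \<comment> \<open>On finitely many coordinates one late term coincides with \<open>l\<close>,
        so the Cauchy bound carries over to the partial sum over \<open>F\<close>.\<close>
      have "eventually (\<lambda>n. (\<forall>a\<in>F. \<sigma> n a = l a) \<and> N \<le> n) sequentially"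
        using l F by (intro eventually_conj eventually_ball_finite eventually_ge_at_top) auto
      then obtain n' where n': "\<forall>a\<in>F. \<sigma> n' a = l a" "N \<le> n'"
        using eventually_happens'[OF sequentially_bot] by blast
      have "(\<Sum>a\<in>F. of_int \<bar>\<sigma> n a - l a\<bar> * norm a) = (\<Sum>a\<in>F. of_int \<bar>\<sigma> n a - \<sigma> n' a\<bar> * norm a)"
        using n'(1) by (intro sum.cong) auto
      also have "\<dots> \<le> hadamard_dist (\<sigma> n) (\<sigma> n')"
        unfolding hadamard_dist_def using sum_le_hadamard_norm[OF formal_sums_diff[OF \<sigma>(1) \<sigma>(1)] F] .
      also have "\<dots> \<le> e" using N[OF n n'(2)] by simp
      finally show ?thesis .
    qed
    have "\<sigma> n 0 - l 0 = 0" using \<sigma>(1)[of n] l0 by (simp add: formal_sums_iff)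
    from hadamard_norm_leI[of "\<lambda>a. \<sigma> n a - l a", OF this bound] show ?thesis
      by (simp add: hadamard_dist_def)
  qed
  have l_in: "l \<in> formal_sums"
  proof -
    obtain N where "\<forall>n n'. N \<le> n \<longrightarrow> N \<le> n' \<longrightarrow> hadamard_dist (\<sigma> n) (\<sigma> n') < 1"
      using \<sigma>(2)[OF zero_less_one] ..
    hence "(\<lambda>a. \<sigma> N a - l a) \<in> formal_sums"
      using close[of N 1 N] by blast
    \<comment> \<open>\<open>l\<close> is recovered as \<open>\<sigma> N\<close> minus the
      difference \<open>\<sigma> N - l\<close>.\<close>
    from formal_sums_diff[OF \<sigma>(1)[of N] this]
    show ?thesis by simp
  qed
  have "\<exists>N. \<forall>n\<ge>N. hadamard_dist (\<sigma> n) l < e" if e: "e > 0" for e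
  proof -
    obtain N where N: "\<forall>n n'. N \<le> n \<longrightarrow> N \<le> n' \<longrightarrow> hadamard_dist (\<sigma> n) (\<sigma> n') < e / 2"
      using \<sigma>(2)[OF half_gt_zero[OF e]] ..
    have "hadamard_dist (\<sigma> n) l < e" if "N \<le> n" for n
      using close[OF N[rule_format] that] e by linarith
    thus ?thesis by blast
  qed
  hence "limitin hadamard.mtopology \<sigma> l sequentially"
    using l_in \<sigma>(1) by (force simp: hadamard.limit_metric_sequentially)
  thus "\<exists>l. limitin hadamard.mtopology \<sigma> l sequentially"
    by blast
qed

lemma closure_of_group_ring: "hadamard.mtopology closure_of group_ring = formal_sums"
proof -
  have "\<exists>l\<in>group_ring. l \<in> hadamard.mball k r" if k: "k \<in> formal_sums" and r: "r > 0" for k r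
  proof -
    have summ: "(\<lambda>a. of_int \<bar>k a\<bar> * norm a) summable_on (- {0})"
      using k by (simp add: formal_sums_iff)
    obtain F where F: "finite F" "F \<subseteq> - {0}"
      "\<And>G. finite G \<Longrightarrow> G \<subseteq> - {0} - F \<Longrightarrow> (\<Sum>a\<in>G. of_int \<bar>k a\<bar> * norm a) < r / 2"
      by (rule summable_on_small_tails[OF summ _ half_gt_zero[OF r]]) simp_all
    \<comment> \<open>Truncation to \<open>F\<close> leaves an error supported on the small
      tail.\<close>
    define l where "l = (\<lambda>a. if a \<in> F then k a else 0)"
    have l: "l \<in> group_ring"
      using F(1,2) by (auto simp: l_def group_ring_def intro: finite_subset[of _ F])
    have "(\<Sum>a\<in>G. of_int \<bar>k a - l a\<bar> * norm a) \<le> r / 2" if G: "finite G" "G \<subseteq> - {0}" for G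
    proof -
      have "(\<Sum>a\<in>G. of_int \<bar>k a - l a\<bar> * norm a) = (\<Sum>a\<in>G - F. of_int \<bar>k a\<bar> * norm a)"
        using G(1) by (intro sum.mono_neutral_cong_right) (auto simp: l_def)
      also have "\<dots> \<le> r / 2" by (rule less_imp_le, rule F(3)) (use G in auto)
      finally show ?thesis .
    qed
    hence "hadamard_dist k l \<le> r / 2"
      unfolding hadamard_dist_def using k l
      by (intro hadamard_norm_leI) (auto simp: formal_sums_iff group_ring_def)
    thus ?thesis using k l r group_ring_subset_formal_sums by (intro bexI[of _ l]) auto
  qed
  thus ?thesis unfolding hadamard.metric_closure_of by blast
qed

section \<open>Hadamard functions\<close>

lemma summable_weight_pos_part: "k \<in> formal_sums \<Longrightarrow> summable_weight (\<lambda>a. nat (k a))"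
  by (erule formal_sums_summable_weight) simp

lemma summable_weight_neg_part: "k \<in> formal_sums \<Longrightarrow> summable_weight (\<lambda>a. nat (- k a))"
  by (erule formal_sums_summable_weight) simp

lemma hadamard_num_eq:
  assumes "k \<in> formal_sums"
  shows "hadamard_num k = canonical_product (\<lambda>a. nat (- k a))"
proof
  fix t
  show "hadamard_num k t = canonical_product (\<lambda>a. nat (- k a)) t"
    unfolding hadamard_num_def num_factor_def
    by (rule family_prod_support[OF summable_weight_neg_part[OF assms]]) auto
qed

lemma hadamard_den_eq:
  assumes "k \<in> formal_sums"
  shows "hadamard_den k = canonical_product (\<lambda>a. nat (k a))"
proof
  fix t
  show "hadamard_den k t = canonical_product (\<lambda>a. nat (k a)) t"
    unfolding hadamard_den_def den_factor_def
    by (rule family_prod_support[OF summable_weight_pos_part[OF assms]]) auto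
qed

lemma uniform_limit_hadamard_num:
  assumes "k \<in> formal_sums" "bounded K"
  shows "uniform_limit K (\<lambda>F t. \<Prod>a\<in>F. num_factor k t a) (hadamard_num k)
           (finite_subsets_at_top {a. k a < 0})"
  unfolding hadamard_num_eq[OF assms(1)] num_factor_def
  by (rule uniform_limit_canonical_product[OF summable_weight_neg_part[OF assms(1)] _ assms(2)]) auto

lemma uniform_limit_hadamard_den:
  assumes "k \<in> formal_sums" "bounded K"
  shows "uniform_limit K (\<lambda>F t. \<Prod>a\<in>F. den_factor k t a) (hadamard_den k)
           (finite_subsets_at_top {a. k a > 0})"
  unfolding hadamard_den_eq[OF assms(1)] den_factor_def
  by (rule uniform_limit_canonical_product[OF summable_weight_pos_part[OF assms(1)] _ assms(2)]) auto

lemma genus_zero_hadamard_num: "k \<in> formal_sums \<Longrightarrow> genus_zero (hadamard_num k)"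
  unfolding hadamard_num_eq
  by (rule genus_zero_canonical_product[OF summable_weight_neg_part]) (auto simp: formal_sums_iff)

lemma genus_zero_hadamard_den: "k \<in> formal_sums \<Longrightarrow> genus_zero (hadamard_den k)"
  unfolding hadamard_den_eq
  by (rule genus_zero_canonical_product[OF summable_weight_pos_part]) (auto simp: formal_sums_iff)

lemma hadamard_num_eq_0_iff:
  "k \<in> formal_sums \<Longrightarrow> hadamard_num k t = 0 \<longleftrightarrow> (\<exists>a. k a < 0 \<and> a * t = 1)"
  by (subst hadamard_num_eq, assumption, subst canonical_product_eq_0_iff[OF summable_weight_neg_part])
     (auto simp: not_le)

lemma hadamard_den_eq_0_iff:
  "k \<in> formal_sums \<Longrightarrow> hadamard_den k t = 0 \<longleftrightarrow> (\<exists>a. k a > 0 \<and> a * t = 1)"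
  by (subst hadamard_den_eq, assumption, subst canonical_product_eq_0_iff[OF summable_weight_pos_part])
     (auto simp: not_le)

text \<open>A common zero \<open>t\<close> would be the reciprocal of a single \<open>a\<close> at
  which \<open>k\<close> is both negative and positive.\<close>

lemma hadamard_no_common_zeros:
  assumes "k \<in> formal_sums"
  shows "hadamard_num k t \<noteq> 0 \<or> hadamard_den k t \<noteq> 0"
proof (rule ccontr)
  assume "\<not> ?thesis"
  then obtain a b where "k a < 0" "a * t = 1" "k b > 0" "b * t = 1"
    using hadamard_num_eq_0_iff[OF assms] hadamard_den_eq_0_iff[OF assms] by auto
  moreover from this have "a = b" by (metis mult.assoc mult.commute mult_1)
  ultimately show False by simp
qed

text \<open>At most one of the exponents is nonzero. The identity includes \<open>x = 0\<close>,
  since the inverse of 0 is 0.\<close>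

lemma power_quotient_eq_power_int: "x ^ nat (- n) / x ^ nat n = x powi (- n)" for x :: "'a :: field"
  by (cases "n \<ge> 0") (auto simp: power_int_def field_simps)

text \<open>Numerator and denominator converge over different index sets; intersecting with each set
  moves both nets to the support of \<open>k\<close>. The condition on \<open>t\<close> keeps the
  denominator nonzero.\<close>

lemma family_prod_powi:
  assumes k: "k \<in> formal_sums" and t: "\<And>a. k a > 0 \<Longrightarrow> a * t \<noteq> 1"
  shows "((\<lambda>F. \<Prod>a\<in>F. (1 - a * t) powi (- k a)) \<longlongrightarrow> hadamard_map k t)
           (finite_subsets_at_top {a. k a \<noteq> 0})"
proof -
  have num: "((\<lambda>F. \<Prod>a\<in>F. num_factor k t a) \<longlongrightarrow> hadamard_num k t)
      (finite_subsets_at_top {a. k a < 0})"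
    using tendsto_uniform_limitI[OF uniform_limit_hadamard_num[OF k, of "{t}"], of t] by simp
  have den: "((\<lambda>F. \<Prod>a\<in>F. den_factor k t a) \<longlongrightarrow> hadamard_den k t)
      (finite_subsets_at_top {a. k a > 0})"
    using tendsto_uniform_limitI[OF uniform_limit_hadamard_den[OF k, of "{t}"], of t] by simp
  have "hadamard_den k t \<noteq> 0" using hadamard_den_eq_0_iff[OF k] t by auto
  hence "((\<lambda>F. (\<Prod>a\<in>F \<inter> {a. k a < 0}. num_factor k t a) / (\<Prod>a\<in>F \<inter> {a. k a > 0}. den_factor k t a))
      \<longlongrightarrow> hadamard_map k t) (finite_subsets_at_top {a. k a \<noteq> 0})"
    unfolding hadamard_map_def
    by (intro tendsto_divide filterlim_compose[OF num filterlim_inter_finite_subsets_at_top]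
        filterlim_compose[OF den filterlim_inter_finite_subsets_at_top]) auto
  thus ?thesis
  proof (rule Lim_transform_eventually, intro eventually_finite_subsets_at_top_weakI)
    fix F :: "complex set" assume F: "finite F"
    have "(\<Prod>a\<in>F \<inter> {a. k a < 0}. num_factor k t a) = (\<Prod>a\<in>F. num_factor k t a)"
      using F
    proof (intro prod.mono_neutral_left ballI)
      fix a assume "a \<in> F - F \<inter> {a. k a < 0}"
      hence "nat (- k a) = 0" by auto
      thus "num_factor k t a = 1" by (simp only: num_factor_def power_0)
    qed auto
    moreover have "(\<Prod>a\<in>F \<inter> {a. k a > 0}. den_factor k t a) = (\<Prod>a\<in>F. den_factor k t a)"
      using F
    proof (intro prod.mono_neutral_left ballI)
      fix a assume "a \<in> F - F \<inter> {a. k a > 0}"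
      hence "nat (k a) = 0" by auto
      thus "den_factor k t a = 1" by (simp only: den_factor_def power_0)
    qed auto
    ultimately show "(\<Prod>a\<in>F \<inter> {a. k a < 0}. num_factor k t a) / (\<Prod>a\<in>F \<inter> {a. k a > 0}. den_factor k t a)
        = (\<Prod>a\<in>F. (1 - a * t) powi (- k a))"
      by (simp add: num_factor_def den_factor_def power_quotient_eq_power_int flip: prod_dividef)
  qed
qed

section \<open>Quotients of entire functions as normalized meromorphic functions\<close>

lemma entire_isCont:
  assumes "g holomorphic_on UNIV"
  shows "isCont g z"
proof -
  have "\<forall>z\<in>UNIV. isCont g z"
    by (rule iffD1[OF continuous_on_eq_continuous_at[OF open_UNIV] holomorphic_on_imp_continuous_on[OF assms]])
  thus ?thesis by blast
qed

lemma entire_eventually_nonzero: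
  assumes "g holomorphic_on UNIV" "g w \<noteq> 0"
  shows "eventually (\<lambda>z. g z \<noteq> 0) (at z0)"
proof (cases "g z0 = 0")
  case True
  show ?thesis
  proof (rule isolated_zeros[OF assms(1) open_UNIV connected_UNIV UNIV_I True UNIV_I assms(2)])
    fix r assume r: "0 < r" "\<And>z. z \<in> ball z0 r - {z0} \<Longrightarrow> g z \<noteq> 0"
    have "g z \<noteq> 0" if "z \<noteq> z0" "dist z z0 < r" for z
      using that by (intro r(2)) (simp add: dist_commute)
    thus ?thesis unfolding eventually_at using r(1) by blast
  qed
next
  case False
  thus ?thesis using entire_isCont[OF assms(1), of z0] by (intro tendsto_imp_eventually_ne) (auto simp: isCont_def)
qed

text \<open>Without common zeros, each zero of \<open>h\<close> is a pole of the quotient, where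
  division by 0 yields exactly the value 0 required of a normalized representative.\<close>

lemma nicely_meromorphic_quotient:
  assumes g: "g holomorphic_on UNIV" and h: "h holomorphic_on UNIV" "h w \<noteq> 0"
    and coprime: "\<And>z. g z \<noteq> 0 \<or> h z \<noteq> 0"
  shows "(\<lambda>z. g z / h z) nicely_meromorphic_on UNIV"
  unfolding nicely_meromorphic_on_def
proof (intro conjI ballI)
  have "g analytic_on UNIV" "h analytic_on UNIV"
    using g h by (simp_all add: analytic_on_open)
  thus "(\<lambda>z. g z / h z) meromorphic_on UNIV"
    by (intro meromorphic_on_divide analytic_on_imp_meromorphic_on)
next
  fix z
  have cont: "isCont g z" "isCont h z"
    by (rule entire_isCont[OF g], rule entire_isCont[OF h(1)])
  show "is_pole (\<lambda>z. g z / h z) z \<and> g z / h z = 0 \<or> (\<lambda>z. g z / h z) \<midarrow>z\<rightarrow> g z / h z"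
  proof (cases "h z = 0")
    case True
    have "filterlim h (at 0) (at z)"
      unfolding filterlim_at using cont(2) entire_eventually_nonzero[OF h] True by (simp add: isCont_def)
    hence "is_pole (\<lambda>z. g z / h z) z"
      using cont(1) coprime[of z] True by (intro is_pole_divide) auto
    thus ?thesis using True by simp
  next
    case False
    thus ?thesis using cont by (auto simp: isCont_def intro: tendsto_divide)
  qed
qed

text \<open>A normalized function is determined at \<open>z\<close> by its values nearby: either it
  has a pole and the value 0, or its value is its limit.\<close>

lemma nicely_meromorphic_eqI:
  assumes "f nicely_meromorphic_on UNIV" "g nicely_meromorphic_on UNIV"
    and ev: "eventually (\<lambda>w. f w = g w) (at z)"
  shows "f z = g z"
proof -
  have "is_pole f z \<longleftrightarrow> is_pole g z"
    by (rule is_pole_cong) (use ev in auto)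
  moreover have "(f \<longlongrightarrow> l) (at z) \<longleftrightarrow> (g \<longlongrightarrow> l) (at z)" for l
    by (rule filterlim_cong) (use ev in auto)
  moreover have "is_pole f z \<and> f z = 0 \<or> (f \<longlongrightarrow> f z) (at z)" "is_pole g z \<and> g z = 0 \<or> (g \<longlongrightarrow> g z) (at z)"
    using assms(1,2) by (auto simp: nicely_meromorphic_on_def)
  moreover have "\<not> is_pole g z" if "(g \<longlongrightarrow> l) (at z)" for l
    using that not_tendsto_and_filterlim_at_infinity[of "at z" g l] unfolding is_pole_def by auto
  ultimately show ?thesis
    using tendsto_unique[of "at z" g] by (metis trivial_limit_at)
qed

lemma hadamard_map_nicely_meromorphic:
  assumes "k \<in> formal_sums"
  shows "hadamard_map k nicely_meromorphic_on UNIV"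
proof -
  have "(\<lambda>t. hadamard_num k t / hadamard_den k t) nicely_meromorphic_on UNIV"
  proof (rule nicely_meromorphic_quotient)
    show "hadamard_num k holomorphic_on UNIV" "hadamard_den k holomorphic_on UNIV"
      unfolding hadamard_num_eq[OF assms] hadamard_den_eq[OF assms]
      by (intro holomorphic_canonical_product summable_weight_neg_part summable_weight_pos_part assms)+
    show "hadamard_den k 0 \<noteq> 0" by (simp add: hadamard_den_eq[OF assms])
  qed (rule hadamard_no_common_zeros[OF assms])
  thus ?thesis by (simp add: hadamard_map_def[abs_def])
qed

lemma hadamard_map_at_0: "k \<in> formal_sums \<Longrightarrow> hadamard_map k 0 = 1"
  by (simp add: hadamard_map_def hadamard_num_eq hadamard_den_eq)

lemma hadamard_map_in_H1:
  assumes "k \<in> formal_sums"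
  shows "hadamard_map k \<in> H1"
proof -
  have "hadamard_den k \<noteq> (\<lambda>_. 0)"
    by (metis assms canonical_product_at_0 hadamard_den_eq zero_neq_one)
  hence "hadamard_function (hadamard_map k)"
    unfolding hadamard_function_def
    using hadamard_map_nicely_meromorphic[OF assms]
      genus_zero_hadamard_num[OF assms] genus_zero_hadamard_den[OF assms]
    by (intro conjI exI[of _ "hadamard_num k"] exI[of _ "hadamard_den k"]) (simp_all add: hadamard_map_def)
  thus ?thesis using hadamard_map_at_0[OF assms] by (simp add: H1_def)
qed

lemma zorder_hadamard_map:
  assumes k: "k \<in> formal_sums" and a: "a \<noteq> 0"
  shows "zorder (hadamard_map k) (1 / a) = - k a"
proof -
  \<comment> \<open>With the factors at \<open>a\<close> removed, \<open>p\<close> and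
    \<open>q\<close> are nonzero at \<open>1 / a\<close>, so the order comes from the removed powers
    alone.\<close>
  define p where "p = canonical_product ((\<lambda>a. nat (- k a))(a := 0))"
  define q where "q = canonical_product ((\<lambda>a. nat (k a))(a := 0))"
  define S where "S = {t. q t \<noteq> 0}"
  have summ: "summable_weight ((\<lambda>a. nat (- k a))(a := 0))" "summable_weight ((\<lambda>a. nat (k a))(a := 0))"
    by (rule summable_weight_mono[OF summable_weight_neg_part[OF k]], simp)
       (rule summable_weight_mono[OF summable_weight_pos_part[OF k]], simp)
  have hol: "p holomorphic_on T" "q holomorphic_on T" for T
    unfolding p_def q_def by (intro holomorphic_canonical_product summ)+
  have nz: "p (1 / a) \<noteq> 0" "q (1 / a) \<noteq> 0"
    unfolding p_def q_def canonical_product_eq_0_iff[OF summ(1)] canonical_product_eq_0_iff[OF summ(2)]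
    by (auto simp: field_simps)
  have "open (q -` (- {0}))"
    using holomorphic_on_imp_continuous_on[OF hol(2)[of UNIV]]
    by (intro open_vimage) auto
  hence S: "open S" by (simp add: S_def vimage_def)
  show ?thesis
  proof (rule zorder_eqI[OF S])
    show "1 / a \<in> S" using nz by (simp add: S_def)
    \<comment> \<open>The constant arises from
      \<open>1 - a * t = (- a) * (t - 1 / a)\<close>.\<close>
    show "(\<lambda>t. (- a) powi (- k a) * (p t / q t)) holomorphic_on S"
      by (intro holomorphic_intros hol) (auto simp: S_def)
    show "(- a) powi (- k a) * (p (1 / a) / q (1 / a)) \<noteq> 0" using nz a by (simp add: power_int_eq_0_iff)
    fix t assume "t \<in> S"
    have "hadamard_map k t = ((1 - a * t) ^ nat (- k a) * p t) / ((1 - a * t) ^ nat (k a) * q t)"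
      unfolding hadamard_map_def hadamard_num_eq[OF k] hadamard_den_eq[OF k] p_def q_def
      using canonical_product_remove[OF summable_weight_neg_part[OF k], of t a]
        canonical_product_remove[OF summable_weight_pos_part[OF k], of t a] by simp
    also have "\<dots> = (1 - a * t) powi (- k a) * (p t / q t)"
      by (simp flip: power_quotient_eq_power_int)
    also have "1 - a * t = (- a) * (t - 1 / a)" using a by (simp add: field_simps)
    finally show "hadamard_map k t = (- a) powi (- k a) * (p t / q t) * (t - 1 / a) powi (- k a)"
      by (simp only: power_int_mult_distrib mult_ac)
  qed
qed

lemma inj_on_hadamard_map: "inj_on hadamard_map formal_sums"
proof
  fix k l assume kl: "k \<in> formal_sums" "l \<in> formal_sums" "hadamard_map k = hadamard_map l"
  show "k = l"
  proof
    fix a show "k a = l a"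
      using zorder_hadamard_map[OF kl(1), of a] zorder_hadamard_map[OF kl(2), of a] kl
      by (cases "a = 0") (auto simp: formal_sums_iff)
  qed
qed

text \<open>For \<open>m > n\<close> the limit would be 0. For \<open>m < n\<close>, multiplying by
  \<open>z ^ (n - m)\<close> leaves the constant \<open>c\<close> tending to 0, so the function
  itself is 0.\<close>

lemma monomial_quotient_tendsto_1:
  fixes c :: complex
  assumes lim: "((\<lambda>z. c * z ^ m / z ^ n) \<longlongrightarrow> 1) (at 0)"
  shows "m = n \<and> c = 1"
proof (cases m n rule: linorder_cases)
  case equal
  have "((\<lambda>z. c * z ^ m / z ^ n) \<longlongrightarrow> c) (at 0)"
    by (rule tendsto_eventually) (auto simp: equal eventually_at intro!: exI[of _ 1])
  hence "c = 1" by (rule tendsto_unique[OF trivial_limit_at _ lim])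
  thus ?thesis using equal by simp
next
  case greater
  have "((\<lambda>z. c * z ^ (m - n)) \<longlongrightarrow> c * 0 ^ (m - n)) (at 0)"
    by (intro tendsto_intros)
  hence "((\<lambda>z. c * z ^ m / z ^ n) \<longlongrightarrow> c * 0 ^ (m - n)) (at 0)"
  proof (rule Lim_transform_eventually)
    show "\<forall>\<^sub>F z in at 0. c * z ^ (m - n) = c * z ^ m / z ^ n"
      using greater by (auto simp: eventually_at power_diff intro!: exI[of _ 1])
  qed
  hence "c * 0 ^ (m - n) = 1" by (rule tendsto_unique[OF trivial_limit_at _ lim])
  thus ?thesis using greater by (simp add: power_0_left)
next
  case less
  have "((\<lambda>z. (c * z ^ m / z ^ n) * z ^ (n - m)) \<longlongrightarrow> 1 * 0 ^ (n - m)) (at 0)"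
    by (intro tendsto_intros lim)
  hence "((\<lambda>z::complex. c) \<longlongrightarrow> 1 * 0 ^ (n - m)) (at 0)"
  proof (rule Lim_transform_eventually)
    show "\<forall>\<^sub>F z in at 0. (c * z ^ m / z ^ n) * z ^ (n - m) = c"
      using less by (auto simp: eventually_at power_diff intro!: exI[of _ 1])
  qed
  hence "1 * 0 ^ (n - m) = c" by (rule tendsto_unique[OF trivial_limit_at tendsto_const, symmetric])
  hence "c = 0" using less by (simp add: power_0_left)
  hence "((\<lambda>z::complex. 0) \<longlongrightarrow> (1 :: complex)) (at 0)" using lim by simp
  hence "(0 :: complex) = 1" by (rule tendsto_unique[OF trivial_limit_at tendsto_const])
  thus ?thesis by simp
qed

text \<open>The common factors, with multiplicities \<open>min (m a) (n a)\<close>, cancel.\<close>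

lemma hadamard_map_eq_canonical_quotient:
  assumes m: "summable_weight m" and n: "summable_weight n" and mn: "m 0 = n 0"
    and z: "canonical_product n z \<noteq> 0"
  shows "hadamard_map (\<lambda>a. int (n a) - int (m a)) z = canonical_product m z / canonical_product n z"
proof -
  let ?k = "\<lambda>a. int (n a) - int (m a)" and ?r = "\<lambda>a. min (m a) (n a)"
  have k: "?k \<in> formal_sums" by (rule summable_weights_formal_sums[OF n m mn[symmetric]])
  have r: "summable_weight ?r" by (rule summable_weight_mono[OF m]) simp
  have "canonical_product (\<lambda>a. ?r a + nat (- ?k a)) z = canonical_product ?r z * hadamard_num ?k z"
    unfolding hadamard_num_eq[OF k]
    by (rule canonical_product_add[OF r summable_weight_neg_part[OF k]])
  also have "(\<lambda>a. ?r a + nat (- ?k a)) = m" by auto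
  finally have 1: "canonical_product m z = canonical_product ?r z * hadamard_num ?k z" .
  have "canonical_product (\<lambda>a. ?r a + nat (?k a)) z = canonical_product ?r z * hadamard_den ?k z"
    unfolding hadamard_den_eq[OF k]
    by (rule canonical_product_add[OF r summable_weight_pos_part[OF k]])
  also have "(\<lambda>a. ?r a + nat (?k a)) = n" by auto
  finally have 2: "canonical_product n z = canonical_product ?r z * hadamard_den ?k z" .
  show ?thesis using 1 2 z by (simp add: hadamard_map_def)
qed

lemma H1_subset_range_hadamard_map:
  assumes "f \<in> H1"
  obtains k where "k \<in> formal_sums" "f = hadamard_map k"
proof -
  have f: "f nicely_meromorphic_on UNIV" "f 0 = 1"
    using assms by (simp_all add: H1_def hadamard_function_def)
  have "\<exists>g h. genus_zero g \<and> genus_zero h \<and> h \<noteq> (\<lambda>_. 0) \<and> (\<forall>z. h z \<noteq> 0 \<longrightarrow> f z = g z / h z)"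
    using assms by (simp add: H1_def hadamard_function_def)
  then obtain g h where gh: "genus_zero g" "genus_zero h" "h \<noteq> (\<lambda>_. 0)"
      "\<forall>z. h z \<noteq> 0 \<longrightarrow> f z = g z / h z"
    by (elim exE conjE)
  obtain m c N where m: "summable_weight m" "m 0 = 0" "\<And>z. g z = c * z ^ N * canonical_product m z"
    by (rule genus_zero_imp_canonical_product[OF gh(1)], rule that)
  obtain n d M where n: "summable_weight n" "n 0 = 0" "\<And>z. h z = d * z ^ M * canonical_product n z"
    by (rule genus_zero_imp_canonical_product[OF gh(2)], rule that)
  have d: "d \<noteq> 0" using gh(3) n(3) by auto
  \<comment> \<open>The sign follows the exponent \<open>- k a\<close> of the product: zeros of the
    denominator count positively.\<close>
  define k where "k = (\<lambda>a. int (n a) - int (m a))"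
  have k: "k \<in> formal_sums"
    unfolding k_def using summable_weights_formal_sums[OF n(1) m(1)] m(2) n(2) by simp
  have ev: "eventually (\<lambda>z. z \<noteq> 0 \<and> canonical_product n z \<noteq> 0) (at z0)" for z0
    by (intro eventually_conj entire_eventually_nonzero[where w = 0]
        entire_eventually_nonzero[of "\<lambda>z. z" 1] holomorphic_canonical_product n(1)) auto
  have eq: "f z = c / d * z ^ N / z ^ M * hadamard_map k z"
    if "z \<noteq> 0" "canonical_product n z \<noteq> 0" for z
  proof -
    have "h z \<noteq> 0" using that d n(3) by simp
    hence "f z = (c * z ^ N * canonical_product m z) / (d * z ^ M * canonical_product n z)"
      using gh(4) m(3) n(3) by simp
    also have "\<dots> = c / d * z ^ N / z ^ M * (canonical_product m z / canonical_product n z)"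
      by simp
    also have "canonical_product m z / canonical_product n z = hadamard_map k z"
      unfolding k_def using hadamard_map_eq_canonical_quotient[OF m(1) n(1) _ that(2)] m(2) n(2) by simp
    finally show ?thesis .
  qed
  \<comment> \<open>The value 1 rules out a pole at 0, as a normalized function is 0 at its
    poles.\<close>
  have tendsto_1: "(u \<longlongrightarrow> 1) (at 0)" if "u nicely_meromorphic_on UNIV" "u 0 = 1" for u :: "complex \<Rightarrow> complex"
    using that unfolding nicely_meromorphic_on_def by (metis UNIV_I zero_neq_one)
  have hk: "(hadamard_map k \<longlongrightarrow> 1) (at 0)"
    by (intro tendsto_1 hadamard_map_nicely_meromorphic hadamard_map_at_0 k)
  have "((\<lambda>z. f z / hadamard_map k z) \<longlongrightarrow> 1 / 1) (at 0)"
    by (intro tendsto_divide tendsto_1 f hk) auto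
  moreover have "\<forall>\<^sub>F z in at 0. f z / hadamard_map k z = c / d * z ^ N / z ^ M"
    using ev[of 0] tendsto_imp_eventually_ne[OF hk zero_neq_one[symmetric]]
    by eventually_elim (use eq in simp)
  ultimately have "((\<lambda>z. c / d * z ^ N / z ^ M) \<longlongrightarrow> 1) (at 0)"
    using Lim_transform_eventually by fastforce
  hence NM: "N = M" "c / d = 1" using monomial_quotient_tendsto_1 by blast+
  have "f = hadamard_map k"
  proof
    fix z
    \<comment> \<open>Exceptional points are isolated, so agreement on punctured neighbourhoods and
      normalization give equality everywhere.\<close>
    have "\<forall>\<^sub>F w in at z. f w = hadamard_map k w"
      using ev[of z] by eventually_elim (use eq NM in simp)
    thus "f z = hadamard_map k z"
      by (rule nicely_meromorphic_eqI[OF f(1) hadamard_map_nicely_meromorphic[OF k]])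
  qed
  with k show ?thesis by (rule that)
qed

lemma bij_betw_hadamard_map: "bij_betw hadamard_map formal_sums H1"
  unfolding bij_betw_def using inj_on_hadamard_map hadamard_map_in_H1
  by (auto elim: H1_subset_range_hadamard_map)

section \<open>Rational functions\<close>

lemma to_fract_prod: "to_fract (\<Prod>x\<in>A. f x) = (\<Prod>x\<in>A. to_fract (f x))"
  by (induction A rule: infinite_finite_induct) auto

lemma to_fract_power: "to_fract (x ^ n) = to_fract x ^ n"
  by (induction n) auto

lemma coprime_poly_no_common_root:
  fixes p q :: "complex poly"
  assumes "coprime p q"
  shows "poly p z \<noteq> 0 \<or> poly q z \<noteq> 0"
proof (rule ccontr)
  assume "\<not> ?thesis"
  hence "[:- z, 1:] dvd p" "[:- z, 1:] dvd q" by (simp_all add: poly_eq_0_iff_dvd)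
  hence "is_unit [:- z, 1:]" using assms coprime_common_divisor by blast
  thus False by (simp add: is_unit_iff_degree)
qed

text \<open>\<open>p\<close> and \<open>q\<close> need not be coprime; at a common zero, however, the right-hand side would be junk.\<close>

lemma rat_eval_quotient:
  assumes q: "q \<noteq> 0" and z: "poly p z \<noteq> 0 \<or> poly q z \<noteq> 0"
  shows "rat_eval (to_fract p / to_fract q) z = poly p z / poly q z"
proof -
  define f where "f = to_fract p / to_fract q"
  define a where "a = fst (quot_of_fract f)"
  define b where "b = snd (quot_of_fract f)"
  have b: "b \<noteq> 0" by (simp add: b_def)
  have "Fract a b = Fract p q"
    by (simp add: a_def b_def) (simp add: f_def Fract_conv_to_fract)
  hence "a * q = p * b" using b q by (simp add: eq_fract)
  hence "poly (a * q) z = poly (p * b) z" by simp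
  hence eq: "poly a z * poly q z = poly p z * poly b z" by simp
  have ab: "poly a z \<noteq> 0 \<or> poly b z \<noteq> 0"
    unfolding a_def b_def by (intro coprime_poly_no_common_root coprime_quot_of_fract)
  have "poly a z / poly b z = poly p z / poly q z"
  proof (cases "poly q z = 0")
    case True
    thus ?thesis using eq z by simp
  next
    case False
    hence "poly b z \<noteq> 0" using eq ab by auto
    thus ?thesis using False eq by (simp add: field_simps)
  qed
  thus ?thesis by (simp add: rat_eval_def a_def b_def f_def)
qed

lemma prod_power_int_to_fract:
  fixes p :: "'i \<Rightarrow> complex poly" and m n :: "'i \<Rightarrow> nat"
  assumes "\<And>x. x \<in> A \<Longrightarrow> p x \<noteq> 0"
  shows "(\<Prod>x\<in>A. to_fract (p x) powi (int (m x) - int (n x))) =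
    to_fract (\<Prod>x\<in>A. p x ^ m x) / to_fract (\<Prod>x\<in>A. p x ^ n x)"
  unfolding to_fract_prod prod_dividef[symmetric]
  by (rule prod.cong) (use assms in \<open>simp_all add: power_int_diff to_fract_power\<close>)

lemma group_ring_to_R1_eq:
  "group_ring_to_R1 k = to_fract (\<Prod>a | k a \<noteq> 0. [:1, - a:] ^ nat (- k a)) /
    to_fract (\<Prod>a | k a \<noteq> 0. [:1, - a:] ^ nat (k a))"
proof -
  have "group_ring_to_R1 k = (\<Prod>a | k a \<noteq> 0. to_fract [:1, - a:] powi (int (nat (- k a)) - int (nat (k a))))"
    unfolding group_ring_to_R1_def by (rule prod.cong) auto
  also have "\<dots> = to_fract (\<Prod>a | k a \<noteq> 0. [:1, - a:] ^ nat (- k a)) /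
    to_fract (\<Prod>a | k a \<noteq> 0. [:1, - a:] ^ nat (k a))"
    by (rule prod_power_int_to_fract) simp
  finally show ?thesis .
qed

text \<open>For finite support both canonical products are polynomials, and these have no common
  zero, so evaluation of the fraction needs no prior reduction.\<close>

lemma rat_eval_group_ring_to_R1:
  assumes k: "k \<in> group_ring"
  shows "rat_eval (group_ring_to_R1 k) = hadamard_map k"
proof
  fix z
  let ?p = "\<Prod>a | k a \<noteq> 0. [:1, - a:] ^ nat (- k a)" and ?q = "\<Prod>a | k a \<noteq> 0. [:1, - a:] ^ nat (k a)"
  have fin: "finite {a. k a \<noteq> 0}" and k': "k \<in> formal_sums"
    using k group_ring_subset_formal_sums by (auto simp: group_ring_def)
  have num: "hadamard_num k z = poly ?p z"
    unfolding hadamard_num_eq[OF k'] by (subst canonical_product_finite[OF fin]) (auto simp: poly_prod mult.commute)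
  have den: "hadamard_den k z = poly ?q z"
    unfolding hadamard_den_eq[OF k'] by (subst canonical_product_finite[OF fin]) (auto simp: poly_prod mult.commute)
  have "?q \<noteq> 0" using fin by (simp add: prod_zero_iff)
  moreover have "poly ?p z \<noteq> 0 \<or> poly ?q z \<noteq> 0"
    using hadamard_no_common_zeros[OF k', of z] by (simp only: num den)
  ultimately show "rat_eval (group_ring_to_R1 k) z = hadamard_map k z"
    unfolding group_ring_to_R1_eq hadamard_map_def num den by (rule rat_eval_quotient)
qed

text \<open>Each root factor is rewritten by \<open>z0 = - z\<close> as \<open>z0\<close> times
  \<open>1 - x / z\<close>, and the collected constant is found by evaluating at 0. Allowing a
  larger \<open>S\<close> lets two polynomials share one index set.\<close>

lemma poly_eq_prod_reciprocal_roots: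
  fixes p :: "complex poly"
  assumes p0: "poly p 0 \<noteq> 0" and S: "finite S" "inverse ` {z. poly p z = 0} \<subseteq> S"
  shows "p = smult (poly p 0) (\<Prod>a\<in>S. [:1, - a:] ^ order (inverse a) p)"
proof -
  have "p \<noteq> 0" using p0 by auto
  define R where "R = {z. poly p z = 0}"
  define P where "P = (\<Prod>a\<in>S. [:1, - a:] ^ order (inverse a) p)"
  have P: "P = (\<Prod>z\<in>R. [:1, - inverse z:] ^ order z p)"
  proof -
    have "order (inverse a) p = 0" if "a \<notin> inverse ` R" for a
      using that by (intro order_0I) (metis (mono_tags) R_def imageI inverse_inverse_eq mem_Collect_eq)
    hence "P = (\<Prod>a\<in>inverse ` R. [:1, - a:] ^ order (inverse a) p)"
      unfolding P_def using S by (intro prod.mono_neutral_right) (auto simp: R_def)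
    thus ?thesis by (simp add: prod.reindex inj_on_def)
  qed
  have "p = smult (lead_coeff p) (\<Prod>z\<in>R. [:- z, 1:] ^ order z p)"
    using complex_poly_decompose[of p] by (simp add: R_def)
  also have "(\<Prod>z\<in>R. [:- z, 1:] ^ order z p) = (\<Prod>z\<in>R. smult ((- z) ^ order z p) ([:1, - inverse z:] ^ order z p))"
  proof (rule prod.cong)
    fix z assume "z \<in> R"
    hence "z \<noteq> 0" using p0 by (auto simp: R_def)
    hence "[:- z, 1:] = smult (- z) [:1, - inverse z:]" by simp
    thus "[:- z, 1:] ^ order z p = smult ((- z) ^ order z p) ([:1, - inverse z:] ^ order z p)"
      by (metis smult_power)
  qed simp
  also have "\<dots> = smult (\<Prod>z\<in>R. (- z) ^ order z p) P"
    unfolding P by (rule prod_smult)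
  also have "smult (lead_coeff p) \<dots> = smult (lead_coeff p * (\<Prod>z\<in>R. (- z) ^ order z p)) P"
    by (rule smult_smult)
  finally have "\<exists>c. p = smult c P" by (rule exI)
  then obtain c where c: "p = smult c P" ..
  have "poly p 0 = poly (smult c P) 0" by (rule arg_cong[OF c])
  also have "\<dots> = c" by (simp add: P_def poly_prod)
  finally have c0: "poly p 0 = c" .
  show ?thesis unfolding P_def[symmetric] c0 by (rule c)
qed

lemma R1_subset_range_group_ring_to_R1:
  assumes "f \<in> R1"
  obtains k where "k \<in> group_ring" "f = group_ring_to_R1 k"
proof -
  define p where "p = fst (quot_of_fract f)"
  define q where "q = snd (quot_of_fract f)"
  have f: "f = to_fract p / to_fract q"
    unfolding p_def q_def by (simp flip: Fract_conv_to_fract)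
  have "poly p 0 / poly q 0 = 1" using assms by (simp add: R1_def rat_eval_def p_def q_def)
  hence pq0: "poly q 0 \<noteq> 0" "poly p 0 = poly q 0" by (auto simp: divide_eq_1_iff)
  hence nz: "p \<noteq> 0" "q \<noteq> 0" by auto
  define S where "S = inverse ` ({z. poly p z = 0} \<union> {z. poly q z = 0})"
  have S: "finite S" "0 \<notin> S"
    unfolding S_def using nz pq0 by (auto intro!: poly_roots_finite)
  \<comment> \<open>The value at \<open>a = 0\<close> is set so that \<open>k 0 = 0\<close>, as
    \<open>group_ring\<close> demands.\<close>
  define m :: "complex poly \<Rightarrow> complex \<Rightarrow> nat"
    where "m = (\<lambda>r a. if a = 0 then 0 else order (inverse a) r)"
  define P where "P = (\<lambda>r. \<Prod>a\<in>S. [:1, - a:] ^ m r a)"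
  define k where "k = (\<lambda>a. int (m q a) - int (m p a))"
  have r_eq: "r = smult (poly r 0) (P r)" if "r \<in> {p, q}" for r
  proof -
    have P: "P r = (\<Prod>a\<in>S. [:1, - a:] ^ order (inverse a) r)"
      unfolding P_def using S by (intro prod.cong) (auto simp: m_def)
    have "poly r 0 \<noteq> 0" using that pq0 by auto
    moreover have "inverse ` {z. poly r z = 0} \<subseteq> S" using that by (auto simp: S_def)
    ultimately show ?thesis
      unfolding P by (intro poly_eq_prod_reciprocal_roots S)
  qed
  have supp: "m p a = 0 \<and> m q a = 0" if "a \<notin> S" for a
  proof -
    have "inverse a \<notin> {z. poly p z = 0} \<union> {z. poly q z = 0}"
      using that unfolding S_def by (metis imageI inverse_inverse_eq)
    thus ?thesis by (auto simp: m_def intro!: order_0I)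
  qed
  have k_S: "{a. k a \<noteq> 0} \<subseteq> S" using supp by (force simp: k_def)
  have "k \<in> group_ring"
    using finite_subset[OF k_S S(1)] by (simp add: group_ring_def k_def m_def)
  moreover have "group_ring_to_R1 k = f"
  proof -
    have "group_ring_to_R1 k = (\<Prod>a\<in>S. to_fract [:1, - a:] powi (- k a))"
      unfolding group_ring_to_R1_def using S k_S by (intro prod.mono_neutral_left) auto
    also have "\<dots> = (\<Prod>a\<in>S. to_fract [:1, - a:] powi (int (m p a) - int (m q a)))"
      by (simp add: k_def)
    also have "\<dots> = to_fract (P p) / to_fract (P q)"
      unfolding P_def by (rule prod_power_int_to_fract) simp
    \<comment> \<open>Since \<open>f\<close> is 1 at 0, numerator and denominator have the same
      nonzero constant term, which may be inserted on both sides.\<close>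
    also have "\<dots> = to_fract ([:poly q 0:] * P p) / to_fract ([:poly q 0:] * P q)"
      unfolding to_fract_mult by (rule mult_divide_mult_cancel_left[symmetric]) (simp add: pq0)
    also have "[:poly q 0:] * P p = smult (poly p 0) (P p)" by (simp add: pq0)
    also have "\<dots> = p" by (rule r_eq[symmetric]) simp
    also have "[:poly q 0:] * P q = smult (poly q 0) (P q)" by simp
    also have "\<dots> = q" by (rule r_eq[symmetric]) simp
    finally show ?thesis using f by simp
  qed
  ultimately show ?thesis using that by blast
qed

text \<open>Injectivity is inherited from \<open>hadamard_map\<close>, because evaluating the
  fraction gives the associated Hadamard function.\<close>

lemma bij_betw_group_ring_to_R1: "bij_betw group_ring_to_R1 group_ring R1"
  unfolding bij_betw_def
proof
  show "inj_on group_ring_to_R1 group_ring"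
  proof
    fix k l assume kl: "k \<in> group_ring" "l \<in> group_ring" "group_ring_to_R1 k = group_ring_to_R1 l"
    hence "hadamard_map k = hadamard_map l"
      by (simp flip: rat_eval_group_ring_to_R1)
    thus "k = l"
      using inj_on_hadamard_map kl group_ring_subset_formal_sums by (meson inj_onD subsetD)
  qed
  have "group_ring_to_R1 k \<in> R1" if "k \<in> group_ring" for k
    using that group_ring_subset_formal_sums
    by (auto simp: R1_def rat_eval_group_ring_to_R1 hadamard_map_at_0)
  thus "group_ring_to_R1 ` group_ring = R1"
    by (auto elim: R1_subset_range_group_ring_to_R1)
qed

lemma bij_betw_R1_to_group_ring: "bij_betw R1_to_group_ring R1 group_ring"
  unfolding R1_to_group_ring_def by (rule bij_betw_the_inv_into[OF bij_betw_group_ring_to_R1])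

text \<open>\<open>R1_dist\<close> is the metric pulled back along an injection with image
  \<open>group_ring\<close>, so the isometry is immediate and only completeness and density carry
  content.\<close>

lemma is_completion_R1: "is_completion R1 R1_dist formal_sums hadamard_dist R1_to_group_ring"
proof -
  have image: "R1_to_group_ring ` R1 = group_ring" and inj: "inj_on R1_to_group_ring R1"
    using bij_betw_R1_to_group_ring by (auto simp: bij_betw_def)
  have maps: "R1_to_group_ring f \<in> formal_sums" if "f \<in> R1" for f
    using that image group_ring_subset_formal_sums by blast
  have "Metric_space R1 R1_dist"
  proof
    show "0 \<le> R1_dist f g" "R1_dist f g = R1_dist g f" for f g
      by (simp_all add: R1_dist_def hadamard.commute)
    show "R1_dist f g = 0 \<longleftrightarrow> f = g" if "f \<in> R1" "g \<in> R1" for f g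
      using that maps inj by (simp add: R1_dist_def inj_on_eq_iff)
    show "R1_dist f h \<le> R1_dist f g + R1_dist g h" if "f \<in> R1" "g \<in> R1" "h \<in> R1" for f g h
      using that maps by (simp add: R1_dist_def hadamard.triangle)
  qed
  thus ?thesis
    unfolding is_completion_def
    using hadamard.Metric_space_axioms mcomplete_formal_sums closure_of_group_ring maps
    by (simp add: R1_dist_def image)
qed

theorem theorem1p3p3:
  shows "bij_betw group_ring_to_R1 group_ring R1
    \<and> is_completion R1 R1_dist formal_sums hadamard_dist R1_to_group_ring
    \<and> (\<forall>k\<in>formal_sums.
         (\<forall>K. compact K \<longrightarrow>
            uniform_limit K (\<lambda>F t. \<Prod>a\<in>F. num_factor k t a) (hadamard_num k)
              (finite_subsets_at_top {a. k a < 0}) \<and>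
            uniform_limit K (\<lambda>F t. \<Prod>a\<in>F. den_factor k t a) (hadamard_den k)
              (finite_subsets_at_top {a. k a > 0})) \<and>
         genus_zero (hadamard_num k) \<and> genus_zero (hadamard_den k) \<and>
         (\<forall>t. (\<forall>a. k a > 0 \<longrightarrow> a * t \<noteq> 1) \<longrightarrow>
            hadamard_map k t = family_prod (\<lambda>a. (1 - a * t) powi (- k a)) {a. k a \<noteq> 0} \<and>
            ((\<lambda>F. \<Prod>a\<in>F. (1 - a * t) powi (- k a)) \<longlongrightarrow> hadamard_map k t)
              (finite_subsets_at_top {a. k a \<noteq> 0})))
    \<and> bij_betw hadamard_map formal_sums H1
    \<and> (\<forall>k\<in>group_ring. hadamard_map k = rat_eval (group_ring_to_R1 k))"
proof (intro conjI ballI allI impI)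
  fix k and K :: "complex set" assume "k \<in> formal_sums" "compact K"
  thus "uniform_limit K (\<lambda>F t. \<Prod>a\<in>F. num_factor k t a) (hadamard_num k)
          (finite_subsets_at_top {a. k a < 0})"
    and "uniform_limit K (\<lambda>F t. \<Prod>a\<in>F. den_factor k t a) (hadamard_den k)
          (finite_subsets_at_top {a. k a > 0})"
    by (simp_all add: uniform_limit_hadamard_num uniform_limit_hadamard_den compact_imp_bounded)
next
  fix k t assume k: "k \<in> formal_sums" and t: "\<forall>a. k a > 0 \<longrightarrow> a * t \<noteq> 1"
  show lim: "((\<lambda>F. \<Prod>a\<in>F. (1 - a * t) powi (- k a)) \<longlongrightarrow> hadamard_map k t)
      (finite_subsets_at_top {a. k a \<noteq> 0})"
    by (rule family_prod_powi[OF k]) (use t in blast)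
  show "hadamard_map k t = family_prod (\<lambda>a. (1 - a * t) powi (- k a)) {a. k a \<noteq> 0}"
    by (rule family_prod_eqI[OF lim, symmetric])
qed (simp_all add: bij_betw_group_ring_to_R1 is_completion_R1 genus_zero_hadamard_num
    genus_zero_hadamard_den bij_betw_hadamard_map rat_eval_group_ring_to_R1)

end
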